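(* Let $\mathcal K$ be a complex Hilbert space and $\mu$ a $\mathcal K$-Carleson measure. Then $i\cdot\mathcal I_\mu$ is a symbol for the Hankel operator $H_\mu$, i.e. $H_\mu=P_+\,M_{i\mathcal I_\mu}R\,P_+$ on $H^2(\mathbb C_+,\mathcal K)$.
   Context: $\mathbb R_+=(0,\infty)$. $H^2(\mathbb C_+,\mathcal K)$ is the Hardy space of holomorphic $f:\mathbb C_+\to\mathcal K$ with $\sup_{y>0}\int\|f(x+iy)\|^2dx<\infty$, identified via boundary values with a closed subspace of $L^2(\mathbb R,\mathcal K)$; $P_+$ is the orthogonal projection onto it. For $h\in L^\infty(\mathbb R,B(\mathcal K))$, $M_h$ is multiplication by $h$, $(Rf)(x)=f(-x)$, and $h$ is a symbol for $H\in B(H^2(\mathbb C_+,\mathcal K))$ if $H=P_+M_hRP_+$. A $\mathcal K$-Carleson measure is a measure $\mu$ on $\mathbb R_+$ with values in the positive bounded operators on $\mathcal K$ such that $(f,g)\mapsto\int_{\mathbb R_+}\langle f(i\lambda),d\mu(\lambda)g(i\lambda)\rangle$ is a continuous sesquilinear form on $H^2(\mathbb C_+,\mathcal K)$, and $H_\mu$ is the bounded operator representing it. $\mathcal N_\mu(z)=\frac1\pi\int_{\mathbb R_+}\big(\frac1{\lambda-iz}-\frac\lambda{1+\lambda^2}\big)d\mu(\lambda)$ for $z\in\mathbb C\setminus i(-\infty,0]$ and $\mathcal I_\mu=\frac1{2i}(\mathcal N_\mu-\mathcal N_\mu^* )$, considered as a function on $\mathbb R\setminus\{0\}$. *)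

theory Defs
  imports "HOL-Analysis.Analysis"
begin

text \<open>The distribution has no class of complex inner product spaces. A complex Hilbert
space is the same thing as a real Hilbert space together with a complex structure J
(multiplication by i): a real-linear isometry with J (J x) = - x. The complex scalar
multiplication and the complex inner product (antilinear in the first argument) are
recovered from the real data below.\<close>

class chilbert = real_inner + complete_space +
  fixes cmult_i :: "'a \<Rightarrow> 'a"
  assumes cmult_i_add: "cmult_i (x + y) = cmult_i x + cmult_i y"
    and cmult_i_scaleR: "cmult_i (r *\<^sub>R x) = r *\<^sub>R cmult_i x"
    and cmult_i_twice: "cmult_i (cmult_i x) = - x"
    and cmult_i_norm: "norm (cmult_i x) = norm x"

instantiation complex :: chilbert
begin
definition cmult_i_complex :: "complex \<Rightarrow> complex" where "cmult_i_complex x = \<i> * x"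
instance
  by standard (auto simp: cmult_i_complex_def norm_mult algebra_simps)
end

definition cscale :: "complex \<Rightarrow> 'a::chilbert \<Rightarrow> 'a" where
  "cscale c x = Re c *\<^sub>R x + Im c *\<^sub>R cmult_i x"

text \<open>complex inner product, antilinear in the first argument\<close>
definition cinner :: "'a::chilbert \<Rightarrow> 'a \<Rightarrow> complex" where
  "cinner x y = Complex (inner x y) (- inner x (cmult_i y))"

definition pos_op :: "('a::chilbert \<Rightarrow> 'a) \<Rightarrow> bool" where
  "pos_op T \<longleftrightarrow> bounded_linear T \<and> (\<forall>x. T (cmult_i x) = cmult_i (T x))
     \<and> (\<forall>x. Im (cinner x (T x)) = 0 \<and> 0 \<le> Re (cinner x (T x)))"

text \<open>square integrable (strongly measurable) K-valued functions on R; strong measurability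
is rendered as Borel measurability plus essentially separable range (Pettis).\<close>
definition L2fun :: "(real \<Rightarrow> 'a::chilbert) \<Rightarrow> bool" where
  "L2fun f \<longleftrightarrow> f \<in> borel_measurable lebesgue
     \<and> (\<exists>D. countable D \<and> (AE x in lebesgue. f x \<in> closure D))
     \<and> integrable lebesgue (\<lambda>x. (norm (f x))\<^sup>2)"

definition l2norm :: "(real \<Rightarrow> 'a::chilbert) \<Rightarrow> real" where
  "l2norm f = sqrt (\<integral>x. (norm (f x))\<^sup>2 \<partial>lebesgue)"

text \<open>hardy2 F f: F is a holomorphic K-valued function on the upper half plane C_+ with
sup_{y>0} \<integral> norm (F (x+iy))^2 dx < \<infinity>, and f \<in> L^2(R,K) is its boundary value
(the L^2-limit of F(.+iy) as y \<rightarrow> 0+). H^2(C_+,K) as a subspace of L^2 is the set of all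
such f, and F (i\<lambda>) is what the paper writes f (i\<lambda>).\<close>
definition hardy2 :: "(complex \<Rightarrow> 'a::chilbert) \<Rightarrow> (real \<Rightarrow> 'a) \<Rightarrow> bool" where
  "hardy2 F f \<longleftrightarrow>
     (\<forall>z. 0 < Im z \<longrightarrow> (\<exists>D. (F has_derivative (\<lambda>h. cscale h D)) (at z)))
   \<and> (\<exists>C. \<forall>y>0. L2fun (\<lambda>x. F (Complex x y)) \<and> (\<integral>x. (norm (F (Complex x y)))\<^sup>2 \<partial>lebesgue) \<le> C)
   \<and> L2fun f
   \<and> ((\<lambda>y. \<integral>x. (norm (F (Complex x y) - f x))\<^sup>2 \<partial>lebesgue) \<longlongrightarrow> 0) (at_right 0)"

text \<open>M A is given for Borel sets A contained in some bounded interval (0,b]; its values are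
positive bounded operators and it is countably additive (in the weak operator sense, which
for positive operators is the same as via the quadratic forms).\<close>
definition opmeasure :: "(real set \<Rightarrow> 'a::chilbert \<Rightarrow> 'a) \<Rightarrow> bool" where
  "opmeasure M \<longleftrightarrow>
     (\<forall>A. A \<in> sets borel \<longrightarrow> (\<exists>b. A \<subseteq> {0<..b}) \<longrightarrow> pos_op (M A))
   \<and> (\<forall>A::nat \<Rightarrow> real set. (\<forall>n. A n \<in> sets borel) \<longrightarrow> disjoint_family A
        \<longrightarrow> (\<exists>b. \<Union>(range A) \<subseteq> {0<..b})
        \<longrightarrow> (\<forall>v. (\<lambda>n. Re (cinner v (M (A n) v))) sums Re (cinner v (M (\<Union>(range A)) v))))"

definition qmeas :: "(real set \<Rightarrow> 'a::chilbert \<Rightarrow> 'a) \<Rightarrow> 'a \<Rightarrow> real measure" where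
  "qmeas M v = measure_of {0<..} (sets (restrict_space borel {0<..}))
      (\<lambda>A. SUP n::nat. ennreal (Re (cinner v (M (A \<inter> {0<..real n}) v))))"

text \<open>\<integral> \<phi>(\<lambda>) d<y, M(\<lambda>) w>, defined by polarization\<close>
definition sint :: "(real set \<Rightarrow> 'a::chilbert \<Rightarrow> 'a) \<Rightarrow> (real \<Rightarrow> complex) \<Rightarrow> 'a \<Rightarrow> 'a \<Rightarrow> complex" where
  "sint M \<phi> y w = (\<Sum>k<4::nat. \<i> ^ k * (\<integral>t. \<phi> t \<partial>qmeas M (w + cscale (\<i> ^ k) y))) / 4"

definition rs_sum :: "(real set \<Rightarrow> 'a::chilbert \<Rightarrow> 'a) \<Rightarrow> (real \<Rightarrow> 'a) \<Rightarrow> (real \<Rightarrow> 'a)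
    \<Rightarrow> real \<Rightarrow> real \<Rightarrow> nat \<Rightarrow> complex" where
  "rs_sum M \<phi> \<psi> a b n =
     (let t = (\<lambda>j::nat. a + real j * (b - a) / real n)
      in \<Sum>j\<in>{1..n}. cinner (\<phi> (t j)) (M {t (j - 1)<..t j} (\<psi> (t j))))"

text \<open>opint M \<phi> \<psi> L: the (improper) integral \<integral>_{R_+} <\<phi>(\<lambda>), dM(\<lambda>) \<psi>(\<lambda>)> exists and equals L
(\<phi>, \<psi> continuous on R_+)\<close>
definition opint :: "(real set \<Rightarrow> 'a::chilbert \<Rightarrow> 'a) \<Rightarrow> (real \<Rightarrow> 'a) \<Rightarrow> (real \<Rightarrow> 'a) \<Rightarrow> complex \<Rightarrow> bool" where
  "opint M \<phi> \<psi> L \<longleftrightarrow>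
     (\<forall>a b. 0 < a \<longrightarrow> a < b \<longrightarrow> convergent (rs_sum M \<phi> \<psi> a b))
   \<and> (\<lambda>n. lim (rs_sum M \<phi> \<psi> (1 / real (Suc n)) (real (Suc n)))) \<longlonglongrightarrow> L"

definition carleson_form :: "(real set \<Rightarrow> 'a::chilbert \<Rightarrow> 'a) \<Rightarrow> (complex \<Rightarrow> 'a) \<Rightarrow> (complex \<Rightarrow> 'a)
    \<Rightarrow> complex \<Rightarrow> bool" where
  "carleson_form M F G L \<longleftrightarrow> opint M (\<lambda>t. F (\<i> * complex_of_real t)) (\<lambda>t. G (\<i> * complex_of_real t)) L"

definition carleson :: "(real set \<Rightarrow> 'a::chilbert \<Rightarrow> 'a) \<Rightarrow> bool" where
  "carleson M \<longleftrightarrow> opmeasure M \<and>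
     (\<exists>C. \<forall>F f G g. hardy2 F f \<longrightarrow> hardy2 G g \<longrightarrow>
        (\<exists>L. carleson_form M F G L \<and> cmod L \<le> C * l2norm f * l2norm g))"

definition nkernel :: "complex \<Rightarrow> real \<Rightarrow> complex" where
  "nkernel z t = 1 / (complex_of_real t - \<i> * z) - complex_of_real (t / (1 + t\<^sup>2))"

text \<open><y, N_mu(z) w>\<close>
definition Nmu :: "(real set \<Rightarrow> 'a::chilbert \<Rightarrow> 'a) \<Rightarrow> complex \<Rightarrow> 'a \<Rightarrow> 'a \<Rightarrow> complex" where
  "Nmu M z y w = sint M (nkernel z) y w / complex_of_real pi"

text \<open><y, I_mu(x) w> for real x, with I_mu = (N_mu - N_mu^* )/(2i)\<close>
definition Imu :: "(real set \<Rightarrow> 'a::chilbert \<Rightarrow> 'a) \<Rightarrow> real \<Rightarrow> 'a \<Rightarrow> 'a \<Rightarrow> complex" where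
  "Imu M x y w = (Nmu M (complex_of_real x) y w - cnj (Nmu M (complex_of_real x) w y)) / (2 * \<i>)"

text \<open>h (given by its matrix coefficients h x y w = <y, h(x) w>) lies in L^\<infinity>(R, B(K)):
weakly measurable and essentially bounded.\<close>
definition Linf_op :: "(real \<Rightarrow> 'a::chilbert \<Rightarrow> 'a \<Rightarrow> complex) \<Rightarrow> bool" where
  "Linf_op h \<longleftrightarrow> (\<forall>y w. (\<lambda>x. h x y w) \<in> borel_measurable lebesgue)
     \<and> (\<exists>C. AE x in lebesgue. \<forall>y w. cmod (h x y w) \<le> C * norm y * norm w)"

text \<open>h is a symbol for H_mu: for all f, g in H^2, <f, H_mu g> = <f, P_+ M_h R P_+ g> = <f, M_h R g>_{L^2}.
Here <f, H_mu g> is by definition the value of the Carleson form.\<close>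
definition symbol_of_Hmu :: "(real \<Rightarrow> 'a::chilbert \<Rightarrow> 'a \<Rightarrow> complex) \<Rightarrow> (real set \<Rightarrow> 'a \<Rightarrow> 'a) \<Rightarrow> bool" where
  "symbol_of_Hmu h M \<longleftrightarrow> Linf_op h \<and>
     (\<forall>F f G g L. hardy2 F f \<longrightarrow> hardy2 G g \<longrightarrow> carleson_form M F G L \<longrightarrow>
        integrable lebesgue (\<lambda>x. h x (f x) (g (- x)))
        \<and> L = (\<integral>x. h x (f x) (g (- x)) \<partial>lebesgue))"

end

theory Submission
  imports Defs "HOL-Complex_Analysis.Complex_Analysis"
begin

text \<open>Since the imaginary part of \<^term>\<open>nkernel x t\<close> is \<^term>\<open>x / (x\<^sup>2 + t\<^sup>2)\<close>, the candidate
  symbol is a superposition of the functions \<^term>\<open>\<i> / pi * (x / (x\<^sup>2 + t\<^sup>2))\<close>. Each of them is a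
  symbol for the point mass at \<^term>\<open>t\<close>: this is Cauchy's formula for the function
  \<^term>\<open>cinner (F (- cnj z)) (T (G z))\<close>, which is absolutely integrable over horizontal lines with
  uniformly bounded integrals. Applied to the cells of a partition, it turns the Riemann-Stieltjes
  sums defining the Carleson form into integrals over the real line, and dominated convergence
  finishes the proof. The dominating function comes from testing the Carleson condition on Szego
  kernels, which gives
  \<^term>\<open>(\<integral>t. 1 / (t + s)\<^sup>2 \<partial>qmeas M v) \<le> C / s * (norm v)\<^sup>2\<close>.\<close>

section \<open>Complex Hilbert spaces\<close>

text \<open>Why the imaginary part of the kernel: \<open>1 / (t - \<i> * x)\<close> and its
  conjugate extend holomorphically to opposite half-planes. Integrated against
  \<open>cinner (f x) (T (g (- x)))\<close>, the first alone gives the point mass at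
  \<open>t\<close> up to a scalar, and the conjugate gives zero. Subtracting the conjugate leaves
  the operator unchanged, but it replaces a kernel of size comparable to
  \<open>1 / (t + \<bar>x\<bar>)\<close>, too large already for Lebesgue measure, by a multiple of
  \<open>x / (x\<^sup>2 + t\<^sup>2)\<close>, whose integrals stay bounded in \<open>x\<close>.

  A second obstacle is that integration against \<open>M\<close> is available only through
  Riemann-Stieltjes sums or, one vector at a time, through \<open>qmeas M v\<close>. Bounds uniform
  in \<open>x\<close>, the partition and the truncation therefore come from quadratic forms. The
  tags are right endpoints and the modulus of the kernel decreases in \<open>t\<close>, so the sums
  of moduli lie below the integral. Polarization and homogeneity turn this into a bound by a
  multiple of \<open>norm y * norm w\<close>.\<close>

lemma inner_cmult_i_cmult_i: "inner (cmult_i x) (cmult_i y) = inner (x::'a::chilbert) y"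
proof -
  have "(norm (cmult_i (x + y)))\<^sup>2 = (norm (x + y))\<^sup>2" for x y :: 'a
    by (simp add: cmult_i_norm)
  then have "inner (cmult_i x + cmult_i y) (cmult_i x + cmult_i y) = inner (x + y) (x + y)"
    by (simp add: cmult_i_add power2_norm_eq_inner)
  moreover have "inner (cmult_i z) (cmult_i z) = inner z z" for z :: 'a
    by (metis cmult_i_norm power2_norm_eq_inner)
  ultimately show ?thesis
    by (simp add: inner_add_left inner_add_right inner_commute)
qed

lemma inner_cmult_i_left: "inner (cmult_i x) y = - inner (x::'a::chilbert) (cmult_i y)"
  using inner_cmult_i_cmult_i[of x "cmult_i y"] by (simp add: cmult_i_twice)

lemma inner_cmult_i_self: "inner x (cmult_i x) = 0" "inner (cmult_i x) x = (0::real)" for x :: "'a::chilbert"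
  using inner_cmult_i_left[of x x] by (auto simp: inner_commute)

lemma norm_cscale: "norm (cscale c x) = cmod c * norm (x::'a::chilbert)"
proof -
  have "(norm (cscale c x))\<^sup>2 = (cmod c * norm x)\<^sup>2"
    unfolding power_mult_distrib cmod_power2 unfolding cscale_def power2_norm_eq_inner
    by (simp add: inner_add_left inner_add_right inner_cmult_i_self inner_cmult_i_cmult_i
        power2_eq_square algebra_simps)
  then show ?thesis by simp
qed

lemma bounded_bilinear_cscale: "bounded_bilinear (cscale :: complex \<Rightarrow> 'a::chilbert \<Rightarrow> 'a)"
proof
  show "\<exists>K. \<forall>a (b::'a). norm (cscale a b) \<le> norm a * norm b * K"
    by (rule exI[of _ 1]) (simp add: norm_cscale)
qed (auto simp: cscale_def cmult_i_add cmult_i_scaleR algebra_simps)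

lemma cscale_mult: "cscale (c * d) x = cscale c (cscale d (x::'a::chilbert))"
  by (simp add: cscale_def cmult_i_add cmult_i_scaleR cmult_i_twice algebra_simps scaleR_add_left scaleR_diff_left)

lemma cscale_1 [simp]: "cscale 1 x = x"
  by (simp add: cscale_def)

lemma cinner_add_left: "cinner (x + y) z = cinner x z + cinner (y::'a::chilbert) z"
  by (simp add: cinner_def complex_eq_iff inner_add_left)

lemma cinner_add_right: "cinner x (y + z) = cinner x y + cinner (x::'a::chilbert) z"
  by (simp add: cinner_def complex_eq_iff inner_add_right cmult_i_add)

lemma cinner_cscale_left: "cinner (cscale c x) y = cnj c * cinner x (y::'a::chilbert)"
  by (simp add: cinner_def cscale_def complex_eq_iff inner_add_left inner_cmult_i_left
      cmult_i_twice algebra_simps)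

lemma cinner_cscale_right: "cinner x (cscale c y) = c * cinner x (y::'a::chilbert)"
  by (simp add: cinner_def cscale_def complex_eq_iff inner_add_right cmult_i_add cmult_i_scaleR
      cmult_i_twice algebra_simps)

text \<open>The factor 2 comes from applying Cauchy-Schwarz to the real and the imaginary part
  separately.\<close>

lemma norm_cinner_le: "cmod (cinner x y) \<le> 2 * (norm x * norm (y::'a::chilbert))"
proof -
  have "cmod (cinner x y) \<le> \<bar>inner x y\<bar> + \<bar>inner x (cmult_i y)\<bar>"
    using cmod_le[of "cinner x y"] by (simp add: cinner_def)
  also have "\<dots> \<le> norm x * norm y + norm x * norm y"
    using Cauchy_Schwarz_ineq2[of x y] Cauchy_Schwarz_ineq2[of x "cmult_i y"]
    by (simp add: cmult_i_norm)
  finally show ?thesis by simp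
qed

lemma bounded_bilinear_cinner: "bounded_bilinear (cinner :: 'a::chilbert \<Rightarrow> 'a \<Rightarrow> complex)"
proof
  show "\<exists>K. \<forall>a (b::'a). norm (cinner a b) \<le> norm a * norm b * K"
    by (intro exI[of _ 2] allI order_trans[OF norm_cinner_le]) simp
qed (simp_all add: cinner_add_left cinner_add_right, simp_all add: cinner_def complex_eq_iff cmult_i_scaleR)

interpretation cinner: bounded_bilinear "cinner :: 'a::chilbert \<Rightarrow> 'a \<Rightarrow> complex"
  by (rule bounded_bilinear_cinner)

interpretation cscale: bounded_bilinear "cscale :: complex \<Rightarrow> 'a::chilbert \<Rightarrow> 'a"
  by (rule bounded_bilinear_cscale)

lemma pos_op_linear: "pos_op T \<Longrightarrow> bounded_linear T"
  by (simp add: pos_op_def)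

lemma pos_op_add: "pos_op T \<Longrightarrow> T (x + y) = T x + T y"
  by (simp add: pos_op_def bounded_linear.linear linear_add)

lemma pos_op_cscale: "pos_op T \<Longrightarrow> T (cscale c x) = cscale c (T x)"
  by (simp add: pos_op_def cscale_def bounded_linear.linear linear_add linear_cmul)

lemma pos_op_nonneg: "pos_op T \<Longrightarrow> 0 \<le> Re (cinner v (T v))"
  by (simp add: pos_op_def)

lemma pos_op_cinner: "pos_op T \<Longrightarrow> cinner v (T v) = complex_of_real (Re (cinner v (T v)))"
  by (simp add: pos_op_def complex_eq_iff)

section \<open>Polarization over the fourth roots of unity\<close>

lemma sum_lessThan_4: "(\<Sum>k<4::nat. f k) = f 0 + f 1 + f 2 + f (3::nat)" for f :: "nat \<Rightarrow> 'b::comm_monoid_add"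
  by (simp add: eval_nat_numeral add.assoc)

text \<open>The scalar leaves the two slots as \<open>cnj c\<close> and \<open>c\<close>, with
  product 1. This makes \<open>qmeas\<close> blind to unimodular factors, which is what relates
  \<open>Nmu\<close> to its adjoint later.\<close>

lemma cscale_of_norm_1:
  assumes "pos_op T" "cmod c = 1"
  shows "cinner (cscale c v) (T (cscale c v)) = cinner v (T v)"
proof -
  have "cnj c * c = 1"
    using assms(2) complex_norm_square[of c] by (simp add: mult.commute)
  then show ?thesis
    by (simp add: pos_op_cscale[OF assms(1)] cinner_cscale_left cinner_cscale_right mult.assoc[symmetric] mult.commute[of c])
qed

text \<open>Orthogonality of characters: among the powers of \<open>\<i> ^ k\<close> on the left,
  only the one belonging to \<open>c\<close> is cancelled by the weight, and the other three sum to
  zero over a full period.\<close>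

lemma sum_fourth_roots:
  "(\<Sum>k<4::nat. \<i> ^ k * (a + \<i> ^ k * b + cnj (\<i> ^ k) * c + cnj (\<i> ^ k) * \<i> ^ k * d)) / 4 = c"
  by (simp add: sum_lessThan_4 complex_eq_iff eval_nat_numeral)

text \<open>Since \<open>cinner\<close> is antilinear on the left, \<open>cinner y (T w)\<close> is
  the coefficient of \<open>cnj c\<close> in the form at \<open>w + cscale c y\<close>. The weights
  are those of \<open>sint\<close>.\<close>

lemma pos_op_polarization:
  assumes "pos_op T"
  shows "cinner y (T w) = (\<Sum>k<4::nat. \<i> ^ k *
    complex_of_real (Re (cinner (w + cscale (\<i> ^ k) y) (T (w + cscale (\<i> ^ k) y))))) / 4"
proof -
  have e: "complex_of_real (Re (cinner (w + cscale c y) (T (w + cscale c y)))) =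
      cinner w (T w) + c * cinner w (T y) + cnj c * cinner y (T w)
      + cnj c * c * cinner y (T y)" for c
    unfolding pos_op_cinner[OF assms, symmetric] using assms
    by (simp add: pos_op_add pos_op_cscale cinner_add_left cinner_add_right cinner_cscale_left
        cinner_cscale_right algebra_simps)
  show ?thesis
    unfolding e by (rule sum_fourth_roots[symmetric])
qed

section \<open>Essentially separable functions on the real line\<close>

text \<open>By completeness of Lebesgue measure, preimages that agree almost everywhere are
  measurable together. The target may be any topological space, as values in a nonseparable Hilbert
  space require.\<close>

lemma borel_measurable_lebesgue_AE_cong:
  fixes f g :: "'a::euclidean_space \<Rightarrow> 'b::topological_space"
  assumes f: "f \<in> borel_measurable lebesgue" and eq: "AE x in lebesgue. f x = g x"
  shows "g \<in> borel_measurable lebesgue"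
proof (rule measurableI)
  fix A :: "'b set" assume "A \<in> sets borel"
  then have "f -` A \<inter> space lebesgue \<in> sets lebesgue"
    by (rule measurable_sets[OF f])
  then show "g -` A \<inter> space lebesgue \<in> sets lebesgue"
  proof (rule completion.in_sets_AE[rotated])
    show "AE x in lebesgue. x \<in> f -` A \<inter> space lebesgue \<longleftrightarrow> x \<in> g -` A \<inter> space lebesgue"
      using eq by eventually_elim auto
  qed simp
qed simp

text \<open>All functions are made constant on a null set containing the points of divergence. The
  convergence is then everywhere, and only a null set has been changed.\<close>

lemma borel_measurable_lebesgue_LIMSEQ_AE:
  fixes u :: "nat \<Rightarrow> 'a::euclidean_space \<Rightarrow> 'b::metric_space"
  assumes u: "\<And>n. u n \<in> borel_measurable lebesgue"
    and lim: "AE x in lebesgue. (\<lambda>n. u n x) \<longlonglongrightarrow> v x"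
  shows "v \<in> borel_measurable lebesgue"
proof -
  obtain N where "{x \<in> space lebesgue. \<not> (\<lambda>n. u n x) \<longlonglongrightarrow> v x} \<subseteq> N"
      "emeasure lebesgue N = 0" "N \<in> sets lebesgue"
    by (rule AE_E[OF lim])
  then have N: "N \<in> null_sets lebesgue" "{x \<in> space lebesgue. \<not> (\<lambda>n. u n x) \<longlonglongrightarrow> v x} \<subseteq> N"
    by auto
  define c where "c = v undefined"
  have [measurable]: "N \<in> sets lebesgue" using N by auto
  have "(\<lambda>x. if x \<in> N then c else v x) \<in> borel_measurable lebesgue"
  proof (rule borel_measurable_LIMSEQ_metric)
    show "(\<lambda>x. if x \<in> N then c else u n x) \<in> borel_measurable lebesgue" for n
      by (rule measurable_If[OF measurable_const u]) auto
    show "(\<lambda>n. if x \<in> N then c else u n x) \<longlonglongrightarrow> (if x \<in> N then c else v x)" for x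
      using N(2) by auto
  qed
  moreover have "AE x in lebesgue. (if x \<in> N then c else v x) = v x"
    using AE_not_in[OF N(1)] by eventually_elim auto
  ultimately show ?thesis
    by (rule borel_measurable_lebesgue_AE_cong)
qed

text \<open>The \<open>n\<close>-th approximant takes the first point of the dense sequence within
  \<open>1 / Suc n\<close> of \<open>f x\<close>. It has countably many values and a measurable
  index. Where no such point exists the index is arbitrary, which concerns only a null set.\<close>

lemma ess_separable_approx:
  fixes f :: "real \<Rightarrow> 'a::metric_space"
  assumes f [measurable]: "f \<in> borel_measurable lebesgue"
    and D: "countable D" "AE x in lebesgue. f x \<in> closure D"
  obtains d :: "nat \<Rightarrow> 'a" and k :: "nat \<Rightarrow> real \<Rightarrow> nat"
  where "\<And>n. k n \<in> measurable lebesgue (count_space UNIV)"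
    and "AE x in lebesgue. (\<lambda>n. d (k n x)) \<longlonglongrightarrow> f x"
proof -
  \<comment> \<open>Inserting a point keeps the set nonempty, so that \<open>from_nat_into\<close>
    enumerates it exactly.\<close>
  define d where "d = from_nat_into (insert undefined D)"
  have rd: "range d = insert undefined D"
    unfolding d_def using D(1) by (simp add: range_from_nat_into)
  define k where "k n x = (LEAST i. dist (f x) (d i) < 1 / real (Suc n))" for n x
  have "k n \<in> measurable lebesgue (count_space UNIV)" for n
  proof -
    have [measurable]: "Measurable.pred lebesgue (\<lambda>x. dist (f x) (d i) < 1 / real (Suc n))" for i
    proof -
      have "f -` ball (d i) (1 / real (Suc n)) \<inter> space lebesgue \<in> sets lebesgue"
        by (rule measurable_sets[OF f]) auto
      moreover have "f -` ball (d i) (1 / real (Suc n)) \<inter> space lebesgue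
          = {x \<in> space lebesgue. dist (f x) (d i) < 1 / real (Suc n)}"
        by (auto simp: dist_commute)
      ultimately show ?thesis by (simp add: pred_def)
    qed
    show ?thesis unfolding k_def by measurable
  qed
  moreover have "AE x in lebesgue. (\<lambda>n. d (k n x)) \<longlonglongrightarrow> f x"
    using D(2)
  proof eventually_elim
    case (elim x)
    have *: "dist (d (k n x)) (f x) < 1 / real (Suc n)" for n
    proof -
      have "0 < 1 / real (Suc n)" by simp
      then obtain y where y: "y \<in> D" "dist y (f x) < 1 / real (Suc n)"
        using elim unfolding closure_approachable by blast
      then obtain i where "y = d i"
        using rd by blast
      then have "dist (f x) (d i) < 1 / real (Suc n)"
        using y by (simp only: dist_commute)
      then have "dist (f x) (d (k n x)) < 1 / real (Suc n)"
        unfolding k_def by (rule LeastI)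
      then show ?thesis by (simp only: dist_commute)
    qed
    show ?case
    proof (subst tendsto_dist_iff, rule Lim_null_comparison)
      show "\<forall>\<^sub>F n in sequentially. norm (dist (d (k n x)) (f x)) \<le> 1 / real (Suc n)"
        unfolding real_norm_def abs_of_nonneg[OF zero_le_dist]
        by (intro always_eventually allI less_imp_le *)
      show "(\<lambda>n. 1 / real (Suc n)) \<longlonglongrightarrow> 0"
        by (rule LIMSEQ_Suc[OF lim_1_over_n])
    qed
  qed
  ultimately show ?thesis by (rule that)
qed

text \<open>The target spaces need not be second countable, so that measurability of \<^term>\<open>\<lambda>x. B (f x) (g x)\<close>
  depends on the essentially separable ranges.\<close>

lemma borel_measurable_compose2_ess_separable:
  fixes f :: "real \<Rightarrow> 'a::metric_space" and g :: "real \<Rightarrow> 'b::metric_space"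
    and B :: "'a \<Rightarrow> 'b \<Rightarrow> 'c::metric_space"
  assumes f: "f \<in> borel_measurable lebesgue" "countable D" "AE x in lebesgue. f x \<in> closure D"
    and g: "g \<in> borel_measurable lebesgue" "countable E" "AE x in lebesgue. g x \<in> closure E"
    and B: "\<And>u w p q. u \<longlonglongrightarrow> p \<Longrightarrow> w \<longlonglongrightarrow> q \<Longrightarrow> (\<lambda>n. B (u n) (w n)) \<longlonglongrightarrow> B p q"
  shows "(\<lambda>x. B (f x) (g x)) \<in> borel_measurable lebesgue"
proof -
  obtain d :: "nat \<Rightarrow> 'a" and k where k: "\<And>n. k n \<in> measurable lebesgue (count_space UNIV)"
      "AE x in lebesgue. (\<lambda>n. d (k n x)) \<longlonglongrightarrow> f x"
    by (rule ess_separable_approx[OF f]) blast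
  obtain e :: "nat \<Rightarrow> 'b" and l where l: "\<And>n. l n \<in> measurable lebesgue (count_space UNIV)"
      "AE x in lebesgue. (\<lambda>n. e (l n x)) \<longlonglongrightarrow> g x"
    by (rule ess_separable_approx[OF g]) blast
  show ?thesis
  proof (rule borel_measurable_lebesgue_LIMSEQ_AE)
    show "(\<lambda>x. B (d (k n x)) (e (l n x))) \<in> borel_measurable lebesgue" for n
    proof (rule measurable_compose_countable[OF _ k(1), where f = "\<lambda>i x. B (d i) (e (l n x))"])
      show "(\<lambda>x. B (d i) (e (l n x))) \<in> borel_measurable lebesgue" for i
        by (rule measurable_compose_countable[OF _ l(1), where f = "\<lambda>j x. B (d i) (e j)"]) simp
    qed
    show "AE x in lebesgue. (\<lambda>n. B (d (k n x)) (e (l n x))) \<longlonglongrightarrow> B (f x) (g x)"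
      using k(2) l(2) by eventually_elim (rule B)
  qed
qed

lemma L2fun_ess_separable:
  assumes "L2fun f"
  obtains D where "f \<in> borel_measurable lebesgue" "countable D" "AE x in lebesgue. f x \<in> closure D"
  using assms unfolding L2fun_def by blast

lemma L2fun_compose2_measurable:
  assumes "L2fun f" "L2fun g"
    and "\<And>u w p q. u \<longlonglongrightarrow> p \<Longrightarrow> w \<longlonglongrightarrow> q \<Longrightarrow> (\<lambda>n. B (u n) (w n)) \<longlonglongrightarrow> (B p q :: 'c::metric_space)"
  shows "(\<lambda>x. B (f x) (g x)) \<in> borel_measurable lebesgue"
proof -
  obtain D where D: "f \<in> borel_measurable lebesgue" "countable D" "AE x in lebesgue. f x \<in> closure D"
    by (rule L2fun_ess_separable[OF assms(1)])
  obtain E where E: "g \<in> borel_measurable lebesgue" "countable E" "AE x in lebesgue. g x \<in> closure E"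
    by (rule L2fun_ess_separable[OF assms(2)])
  show ?thesis
    by (rule borel_measurable_compose2_ess_separable[OF D E assms(3)])
qed

section \<open>Reflection of the real line\<close>

lemma measurable_lebesgue_uminus: "uminus \<in> measurable lebesgue (lebesgue :: real measure)"
proof -
  have "(*\<^sub>R) (-1) = (uminus :: real \<Rightarrow> real)" by auto
  then show ?thesis using lebesgue_measurable_scaling[of "-1", where 'a = real] by simp
qed

lemma distr_lebesgue_uminus: "distr lebesgue lebesgue uminus = (lebesgue :: real measure)"
  using lebesgue_real_scale[of "-1"] by (simp add: density_1)

lemma integrable_lebesgue_reflect:
  fixes h :: "real \<Rightarrow> 'b::{banach, second_countable_topology}"
  assumes "integrable lebesgue h"
  shows "integrable lebesgue (\<lambda>x. h (- x))"
  using integrable_distr[OF measurable_lebesgue_uminus, of h] assms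
  by (simp add: distr_lebesgue_uminus)

lemma integral_lebesgue_reflect:
  fixes h :: "real \<Rightarrow> 'b::{banach, second_countable_topology}"
  assumes "h \<in> borel_measurable lebesgue"
  shows "(\<integral>x. h (- x) \<partial>lebesgue) = (\<integral>x. h x \<partial>lebesgue)"
  using integral_distr[OF measurable_lebesgue_uminus assms] by (simp add: distr_lebesgue_uminus)

lemma AE_lebesgue_reflect:
  assumes "AE x in lebesgue. P (x::real)"
  shows "AE x in lebesgue. P (- x)"
  by (rule AE_distrD[OF measurable_lebesgue_uminus]) (simp only: distr_lebesgue_uminus assms)

lemma L2fun_reflect:
  assumes "L2fun f"
  shows "L2fun (\<lambda>x. f (- x))"
  unfolding L2fun_def
proof (intro conjI)
  show "(\<lambda>x. f (- x)) \<in> borel_measurable lebesgue"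
    using measurable_compose[OF measurable_lebesgue_uminus, of f borel] assms unfolding L2fun_def by simp
  show "\<exists>D. countable D \<and> (AE x in lebesgue. f (- x) \<in> closure D)"
  proof -
    obtain D where "countable D" "AE x in lebesgue. f x \<in> closure D"
      by (rule L2fun_ess_separable[OF assms])
    then show ?thesis
      by (intro exI[of _ D] conjI AE_lebesgue_reflect[of "\<lambda>x. f x \<in> closure D"])
  qed
  show "integrable lebesgue (\<lambda>x. (norm (f (- x)))\<^sup>2)"
    using integrable_lebesgue_reflect[of "\<lambda>x. (norm (f x))\<^sup>2"] assms unfolding L2fun_def by simp
qed

section \<open>The scalar measures of an operator measure\<close>

definition qform :: "(real set \<Rightarrow> 'a::chilbert \<Rightarrow> 'a) \<Rightarrow> 'a \<Rightarrow> real set \<Rightarrow> real" where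
  "qform M v A = Re (cinner v (M A v))"

lemma opmeasure_pos_op:
  "opmeasure M \<Longrightarrow> A \<in> sets borel \<Longrightarrow> A \<subseteq> {0<..b} \<Longrightarrow> pos_op (M A)"
  unfolding opmeasure_def by blast

lemma qform_nonneg:
  "opmeasure M \<Longrightarrow> A \<in> sets borel \<Longrightarrow> A \<subseteq> {0<..b} \<Longrightarrow> 0 \<le> qform M v A"
  unfolding qform_def by (rule pos_op_nonneg[OF opmeasure_pos_op])

lemma qform_sums:
  assumes "opmeasure M" "\<And>n::nat. A n \<in> sets borel" "disjoint_family A" "\<Union>(range A) \<subseteq> {0<..b}"
  shows "(\<lambda>n. qform M v (A n)) sums qform M v (\<Union>(range A))"
  using assms unfolding opmeasure_def qform_def by blast

lemma qform_empty:
  assumes "opmeasure M"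
  shows "qform M v {} = 0"
proof -
  \<comment> \<open>The empty set is the disjoint union of infinitely many copies of itself, and a
    constant series converges only if its terms vanish.\<close>
  have "(\<lambda>n::nat. qform M v {}) sums qform M v (\<Union>(range (\<lambda>n::nat. {})))"
    by (rule qform_sums[OF assms]) (auto simp: disjoint_family_on_def)
  then show ?thesis
    using sums_summable summable_const_iff by blast
qed

lemma qform_Un:
  assumes M: "opmeasure M" and A: "A \<in> sets borel" "B \<in> sets borel" "A \<inter> B = {}" "A \<union> B \<subseteq> {0<..b}"
  shows "qform M v (A \<union> B) = qform M v A + qform M v B"
proof -
  have "(\<lambda>n. qform M v (binaryset A B n)) sums qform M v (\<Union>(range (binaryset A B)))"
    by (rule qform_sums[OF M, where b = b])
      (use A in \<open>auto simp: UN_binaryset_eq binaryset_def disjoint_family_on_def split: if_splits\<close>)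
  moreover have "(\<lambda>n. qform M v (binaryset A B n)) sums (qform M v A + qform M v B)"
    by (rule binaryset_sums) (rule qform_empty[OF M])
  ultimately show ?thesis
    by (simp add: UN_binaryset_eq sums_unique2)
qed

lemma qform_mono:
  assumes M: "opmeasure M" and A: "A \<in> sets borel" "B \<in> sets borel" "A \<subseteq> B" "B \<subseteq> {0<..b}"
  shows "qform M v A \<le> qform M v B"
proof -
  have "A \<union> (B - A) = B" using A by auto
  then have "qform M v B = qform M v A + qform M v (B - A)"
    using qform_Un[OF M A(1), of "B - A" b v] A by auto
  moreover have "0 \<le> qform M v (B - A)"
    by (rule qform_nonneg[OF M, of _ b]) (use A in auto)
  ultimately show ?thesis by simp
qed

lemma space_qmeas [simp]: "space (qmeas M v) = {0<..}"
  unfolding qmeas_def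
  by (rule space_measure_of) (auto simp: sets_restrict_space)

lemma sets_qmeas: "sets (qmeas M v) = sets (restrict_space borel {0<..})"
proof -
  have "sigma_sets {0<..} (sets (restrict_space borel {0::real<..})) = sets (restrict_space borel {0<..})"
    using sets.sigma_sets_eq[of "restrict_space borel {0::real<..}"] by (simp add: space_restrict_space)
  then show ?thesis
    unfolding qmeas_def by (subst sets_measure_of) (auto simp: sets_restrict_space)
qed

lemma sets_qmeas_iff: "A \<in> sets (qmeas M v) \<longleftrightarrow> A \<in> sets borel \<and> A \<subseteq> {0<..}"
  unfolding sets_qmeas by (subst sets_restrict_space_iff) auto

lemma measurable_qmeas_continuous:
  fixes \<phi> :: "real \<Rightarrow> 'b::topological_space"
  assumes "continuous_on {0<..} \<phi>"
  shows "\<phi> \<in> borel_measurable (qmeas M v)"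
  using borel_measurable_continuous_on_restrict[OF assms]
  by (simp cong: measurable_cong_sets add: measurable_cong_sets[OF sets_qmeas refl])

text \<open>The operator measure is additive only inside bounded intervals. The truncated values
  increase with \<open>n\<close>, so the supremum may be exchanged with the series, and countable
  additivity passes to the whole half-line. Only then does \<open>measure_of\<close> return the
  prescribed set function.\<close>

lemma emeasure_qmeas:
  assumes M: "opmeasure M" and A: "A \<in> sets borel" "A \<subseteq> {0<..}"
  shows "emeasure (qmeas M v) A = (SUP n::nat. ennreal (qform M v (A \<inter> {0<..real n})))"
proof -
  let ?\<mu> = "\<lambda>A. SUP n::nat. ennreal (qform M v (A \<inter> {0<..real n}))"
  let ?R = "restrict_space borel {0::real<..}"
  have nn: "0 \<le> qform M v (B \<inter> {0<..real n})" if "B \<in> sets borel" for B n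
    by (rule qform_nonneg[OF M, of _ "real n"]) (use that in auto)
  have "countably_additive (sets ?R) ?\<mu>"
  proof (rule countably_additiveI)
    fix B :: "nat \<Rightarrow> real set"
    assume B: "range B \<subseteq> sets ?R" "disjoint_family B" "\<Union>(range B) \<in> sets ?R"
    have Bm: "B i \<in> sets borel" for i
    proof -
      have "B i \<in> sets ?R" using B(1) by auto
      then show ?thesis by (subst (asm) sets_restrict_space_iff) auto
    qed
    have "(\<Sum>i. ?\<mu> (B i)) = (SUP n. \<Sum>i. ennreal (qform M v (B i \<inter> {0<..real n})))"
    proof (rule ennreal_suminf_SUP_eq)
      fix i
      show "incseq (\<lambda>n. ennreal (qform M v (B i \<inter> {0<..real n})))"
      proof (rule incseq_SucI, rule ennreal_leI)
        fix n
        show "qform M v (B i \<inter> {0<..real n}) \<le> qform M v (B i \<inter> {0<..real (Suc n)})"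
          by (rule qform_mono[OF M, of _ _ "real (Suc n)"]) (use Bm in auto)
      qed
    qed
    moreover have "(\<Sum>i. ennreal (qform M v (B i \<inter> {0<..real n}))) = ennreal (qform M v (\<Union>(range B) \<inter> {0<..real n}))" for n
    proof -
      have "(\<lambda>i. qform M v (B i \<inter> {0<..real n})) sums qform M v (\<Union>i. B i \<inter> {0<..real n})"
        by (rule qform_sums[OF M, of _ "real n"])
          (use B(2) Bm in \<open>auto simp: disjoint_family_on_def\<close>)
      then show ?thesis
        using nn[OF Bm] by (subst suminf_ennreal_eq) auto
    qed
    ultimately show "(\<Sum>i. ?\<mu> (B i)) = ?\<mu> (\<Union>(range B))" by simp
  qed
  moreover have "positive (sets ?R) ?\<mu>"
    by (simp add: positive_def qform_empty[OF M])
  moreover have "sigma_algebra {0<..} (sets ?R)"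
    using sets.sigma_algebra_axioms[of ?R] by (simp add: space_restrict_space)
  moreover have "A \<in> sets ?R"
    using A by (subst sets_restrict_space_iff) auto
  ultimately show ?thesis
    unfolding qmeas_def qform_def[symmetric] by (intro emeasure_measure_of_sigma)
qed

text \<open>Truncation at \<open>n\<close> no longer affects the set once \<open>n\<close> exceeds
  \<open>b\<close>, so the supremum is attained.\<close>

lemma emeasure_qmeas_bounded:
  assumes M: "opmeasure M" and A: "A \<in> sets borel" "A \<subseteq> {0<..b}"
  shows "emeasure (qmeas M v) A = ennreal (qform M v A)"
proof -
  obtain N where N: "b \<le> real N"
    using real_arch_simple by blast
  have "A \<subseteq> {0<..}" using A by auto
  then have "emeasure (qmeas M v) A = (SUP n::nat. ennreal (qform M v (A \<inter> {0<..real n})))"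
    by (rule emeasure_qmeas[OF M A(1)])
  also have "\<dots> = ennreal (qform M v A)"
  proof (rule antisym)
    show "(SUP n::nat. ennreal (qform M v (A \<inter> {0<..real n}))) \<le> ennreal (qform M v A)"
      by (intro SUP_least ennreal_leI qform_mono[OF M _ A(1) _ A(2)]) (use A in auto)
    have "A \<inter> {0<..real N} = A" using A N by force
    then show "ennreal (qform M v A) \<le> (SUP n::nat. ennreal (qform M v (A \<inter> {0<..real n})))"
      by (intro SUP_upper2[of N]) auto
  qed
  finally show ?thesis .
qed

lemma measure_qmeas_bounded:
  assumes M: "opmeasure M" and A: "A \<in> sets borel" "A \<subseteq> {0<..b}"
  shows "measure (qmeas M v) A = qform M v A"
  unfolding measure_def emeasure_qmeas_bounded[OF assms] using qform_nonneg[OF assms] by simp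

lemma qmeas_cscale:
  assumes M: "opmeasure M" and c: "cmod c = 1"
  shows "qmeas M (cscale c v) = qmeas M v"
proof (rule measure_eqI)
  show "sets (qmeas M (cscale c v)) = sets (qmeas M v)"
    by (simp add: sets_qmeas)
  fix A assume "A \<in> sets (qmeas M (cscale c v))"
  then have A: "A \<in> sets borel" "A \<subseteq> {0<..}"
    by (auto simp: sets_qmeas_iff)
  have "qform M (cscale c v) (A \<inter> {0<..real n}) = qform M v (A \<inter> {0<..real n})" for n
  proof -
    have "pos_op (M (A \<inter> {0<..real n}))"
      by (rule opmeasure_pos_op[OF M, of _ "real n"]) (use A in auto)
    then show ?thesis
      unfolding qform_def by (simp add: cscale_of_norm_1 c)
  qed
  then show "emeasure (qmeas M (cscale c v)) A = emeasure (qmeas M v) A"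
    by (simp add: emeasure_qmeas[OF M A])
qed

section \<open>Riemann-Stieltjes sums\<close>

definition grid :: "real \<Rightarrow> real \<Rightarrow> nat \<Rightarrow> nat \<Rightarrow> real" where
  "grid a b n j = a + real j * (b - a) / real n"

definition cell :: "real \<Rightarrow> real \<Rightarrow> nat \<Rightarrow> nat \<Rightarrow> real set" where
  "cell a b n j = {grid a b n (j - 1)<..grid a b n j}"

text \<open>The cells are open on the left and closed on the right, hence the ceiling.\<close>

definition cell_index :: "real \<Rightarrow> real \<Rightarrow> nat \<Rightarrow> real \<Rightarrow> nat" where
  "cell_index a b n t = nat \<lceil>(t - a) * real n / (b - a)\<rceil>"

lemma rs_sum_cells:
  "rs_sum M \<phi> \<psi> a b n = (\<Sum>j\<in>{1..n}. cinner (\<phi> (grid a b n j)) (M (cell a b n j) (\<psi> (grid a b n j))))"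
  by (simp add: rs_sum_def cell_def grid_def Let_def)

lemma sets_cell [simp]: "cell a b n j \<in> sets borel"
  by (simp add: cell_def)

lemma grid_mono: "a \<le> b \<Longrightarrow> i \<le> j \<Longrightarrow> grid a b n i \<le> grid a b n j"
  by (simp add: grid_def divide_right_mono mult_right_mono)

lemma grid_bounds:
  assumes "a \<le> b" "j \<in> {1..n}"
  shows "a \<le> grid a b n j" "grid a b n j \<le> b"
proof -
  show "a \<le> grid a b n j" using grid_mono[OF assms(1), of 0 j n] by (simp add: grid_def)
  have "grid a b n n = b" using assms(2) by (simp add: grid_def)
  then show "grid a b n j \<le> b" using grid_mono[OF assms(1), of j n n] assms(2) by simp
qed

lemma cell_subset:
  assumes "0 < a" "a \<le> b" "j \<in> {1..n}"
  shows "cell a b n j \<subseteq> {0<..b}"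
proof -
  have "a \<le> grid a b n (j - 1)" using grid_mono[OF assms(2), of 0 "j - 1" n] by (simp add: grid_def)
  then show ?thesis using grid_bounds[OF assms(2,3)] assms(1) unfolding cell_def by auto
qed

text \<open>In the rescaled coordinate \<open>s\<close> the cells become the intervals from
  \<open>j - 1\<close> (excluded) to \<open>j\<close> (included), that is, the level sets of the
  ceiling.\<close>

lemma mem_cell_iff:
  assumes ab: "a < b" and j: "j \<in> {1..n}"
  shows "t \<in> cell a b n j \<longleftrightarrow> t \<in> {a<..b} \<and> j = cell_index a b n t"
proof -
  define s where "s = (t - a) * real n / (b - a)"
  have n: "0 < real n" using j by auto
  have t: "t = a + s * (b - a) / real n"
    using ab n by (simp add: s_def)
  have lt: "a + x * (b - a) / real n < a + y * (b - a) / real n \<longleftrightarrow> x < y" for x y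
    using ab n by (simp add: divide_less_cancel mult_less_cancel_right)
  have le: "a + x * (b - a) / real n \<le> a + y * (b - a) / real n \<longleftrightarrow> x \<le> y" for x y
    using lt[of y x] by linarith
  have "t \<in> cell a b n j \<longleftrightarrow> real (j - 1) < s \<and> s \<le> real j"
    unfolding cell_def grid_def t greaterThanAtMost_iff lt le ..
  also have "\<dots> \<longleftrightarrow> \<lceil>s\<rceil> = int j"
    using j by (simp add: ceiling_eq_iff of_nat_diff)
  finally have c: "t \<in> cell a b n j \<longleftrightarrow> \<lceil>s\<rceil> = int j" .
  have "a < t \<longleftrightarrow> 0 < s" "t \<le> b \<longleftrightarrow> s \<le> real n"
    using lt[of 0 s] le[of s "real n"] n unfolding t[symmetric] by auto
  then have "t \<in> {a<..b} \<longleftrightarrow> 0 < \<lceil>s\<rceil> \<and> \<lceil>s\<rceil> \<le> int n"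
    by (simp add: ceiling_le_iff)
  moreover have "k = int j \<longleftrightarrow> (0 < k \<and> k \<le> int n) \<and> j = nat k" for k
    using j by auto
  ultimately show ?thesis
    unfolding c cell_index_def s_def[symmetric] by simp
qed

lemma cell_index_in:
  assumes ab: "a < b" and n: "0 < n" and t: "t \<in> {a<..b}"
  shows "cell_index a b n t \<in> {1..n}"
proof -
  define s where "s = (t - a) * real n / (b - a)"
  have "0 < s" using assms by (simp add: s_def)
  moreover have "s \<le> real n"
    using assms by (simp add: s_def divide_le_eq mult.commute mult_left_mono)
  ultimately have "0 < \<lceil>s\<rceil>" "\<lceil>s\<rceil> \<le> int n" by (simp_all add: ceiling_le_iff)
  then show ?thesis unfolding cell_index_def s_def[symmetric] atLeastAtMost_iff by linarith
qed

lemma grid_cell_index: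
  assumes ab: "a < b" and n: "0 < n" and t: "t \<in> {a<..b}"
  shows "t \<le> grid a b n (cell_index a b n t)" "grid a b n (cell_index a b n t) < t + (b - a) / real n"
proof -
  let ?j = "cell_index a b n t"
  have j: "?j \<in> {1..n}" by (rule cell_index_in[OF assms])
  then have "t \<in> cell a b n ?j" using mem_cell_iff[OF ab j] t by simp
  moreover have "grid a b n ?j = grid a b n (?j - 1) + (b - a) / real n"
    using j by (simp add: grid_def of_nat_diff field_simps add_divide_distrib[symmetric])
  ultimately show "t \<le> grid a b n ?j" "grid a b n ?j < t + (b - a) / real n"
    unfolding cell_def by auto
qed

text \<open>Exactly one cell contains a given point of the interval. The right-hand form is a step
  function, to which dominated convergence over the partitions applies.\<close>

lemma cell_step_sum:
  fixes \<phi> :: "nat \<Rightarrow> 'b::real_vector"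
  assumes "a < b" "0 < n"
  shows "(\<Sum>j\<in>{1..n}. indicator (cell a b n j) t *\<^sub>R \<phi> j) = indicator {a<..b} t *\<^sub>R \<phi> (cell_index a b n t)"
proof (cases "t \<in> {a<..b}")
  case True
  have "(\<Sum>j\<in>{1..n}. indicator (cell a b n j) t *\<^sub>R \<phi> j) =
      (\<Sum>j\<in>{1..n}. if j = cell_index a b n t then \<phi> j else 0)"
    using True by (intro sum.cong refl) (simp add: indicator_def mem_cell_iff[OF assms(1)])
  also have "\<dots> = \<phi> (cell_index a b n t)"
    using cell_index_in[OF assms True] by (subst sum.delta) auto
  finally show ?thesis using True by simp
next
  case False
  have "(\<Sum>j\<in>{1..n}. indicator (cell a b n j) t *\<^sub>R \<phi> j) = 0"
    using False mem_cell_iff[OF assms(1), of _ n t] by (intro sum.neutral ballI) (auto simp: indicator_def)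
  then show ?thesis using False by simp
qed

lemma
  fixes \<phi> :: "nat \<Rightarrow> 'b::{banach, second_countable_topology}"
  assumes M: "opmeasure M" and ab: "0 < a" "a < b" and n: "0 < n"
  shows integrable_cell_step:
      "integrable (qmeas M v) (\<lambda>t. indicator {a<..b} t *\<^sub>R \<phi> (cell_index a b n t))"
    and integral_cell_step:
      "(\<integral>t. indicator {a<..b} t *\<^sub>R \<phi> (cell_index a b n t) \<partial>qmeas M v)
        = (\<Sum>j\<in>{1..n}. qform M v (cell a b n j) *\<^sub>R \<phi> j)"
proof -
  have s: "cell a b n j \<subseteq> {0<..b}" if "j \<in> {1..n}" for j
    using cell_subset[of a b j n] ab that by simp
  have i: "integrable (qmeas M v) (\<lambda>t. indicator (cell a b n j) t *\<^sub>R \<phi> j)" if j: "j \<in> {1..n}" for j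
    using s[OF j] emeasure_qmeas_bounded[OF M _ s[OF j], of v]
    by (intro integrable_scaleR_left integrable_real_indicator)
      (auto simp: sets_qmeas_iff)
  show "integrable (qmeas M v) (\<lambda>t. indicator {a<..b} t *\<^sub>R \<phi> (cell_index a b n t))"
    unfolding cell_step_sum[OF ab(2) n, symmetric] by (intro Bochner_Integration.integrable_sum i)
  show "(\<integral>t. indicator {a<..b} t *\<^sub>R \<phi> (cell_index a b n t) \<partial>qmeas M v)
        = (\<Sum>j\<in>{1..n}. qform M v (cell a b n j) *\<^sub>R \<phi> j)"
    unfolding cell_step_sum[OF ab(2) n, symmetric]
  proof (subst Bochner_Integration.integral_sum[OF i], assumption, rule sum.cong[OF refl])
    fix j assume j: "j \<in> {1..n}"
    have "cell a b n j \<subseteq> {0<..}"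
      using s[OF j] by force
    then have "(\<integral>t. indicator (cell a b n j) t *\<^sub>R \<phi> j \<partial>qmeas M v) = measure (qmeas M v) (cell a b n j) *\<^sub>R \<phi> j"
      using s[OF j] emeasure_qmeas_bounded[OF M _ s[OF j], of v]
      by (subst integral_scaleR_left) (auto simp: sets_qmeas_iff Int_absorb2 intro!: integrable_real_indicator)
    then show "(\<integral>t. indicator (cell a b n j) t *\<^sub>R \<phi> j \<partial>qmeas M v) = qform M v (cell a b n j) *\<^sub>R \<phi> j"
      using measure_qmeas_bounded[OF M _ s[OF j], of v] by simp
  qed
qed

lemma cell_step_LIMSEQ:
  fixes \<phi> :: "real \<Rightarrow> 'b::topological_space"
  assumes \<phi>: "continuous_on {0<..} \<phi>" and ab: "0 < a" "a < b" and t: "t \<in> {a<..b}"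
  shows "(\<lambda>n. \<phi> (grid a b n (cell_index a b n t))) \<longlonglongrightarrow> \<phi> t"
proof -
  have "(\<lambda>n. grid a b n (cell_index a b n t)) \<longlonglongrightarrow> t"
  proof (rule tendsto_sandwich)
    show "\<forall>\<^sub>F n in sequentially. t \<le> grid a b n (cell_index a b n t)"
      using eventually_gt_at_top[of "0::nat"]
      by eventually_elim (rule grid_cell_index(1)[OF ab(2) _ t])
    show "\<forall>\<^sub>F n in sequentially. grid a b n (cell_index a b n t) \<le> t + (b - a) * (1 / real n)"
      using eventually_gt_at_top[of "0::nat"]
      by eventually_elim (use grid_cell_index(2)[OF ab(2) _ t] in \<open>simp add: less_imp_le\<close>)
    have "(\<lambda>n. t + (b - a) * (1 / real n)) \<longlonglongrightarrow> t + (b - a) * 0"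
      by (intro tendsto_intros lim_1_over_n)
    then show "(\<lambda>n. t + (b - a) * (1 / real n)) \<longlonglongrightarrow> t" by simp
  qed (rule tendsto_const)
  moreover have "isCont \<phi> t"
    using \<phi> t ab by (simp add: continuous_on_eq_continuous_at)
  ultimately show ?thesis by (rule isCont_tendsto_compose[rotated])
qed

text \<open>The sums are integrals of step functions taking at \<open>t\<close> the value of
  \<open>\<phi>\<close> at the right end of the cell of \<open>t\<close>. These converge by
  continuity and are dominated by the maximum of \<open>\<phi>\<close> on the compact interval,
  where \<open>qmeas M v\<close> is finite.\<close>

lemma
  fixes \<phi> :: "real \<Rightarrow> 'b::{banach, second_countable_topology}"
  assumes M: "opmeasure M" and ab: "0 < a" "a < b" and \<phi>: "continuous_on {0<..} \<phi>"
  shows integrable_qmeas_interval: "integrable (qmeas M v) (\<lambda>t. indicator {a<..b} t *\<^sub>R \<phi> t)"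
    and riemann_stieltjes_qmeas:
      "(\<lambda>n. \<Sum>j\<in>{1..n}. qform M v (cell a b n j) *\<^sub>R \<phi> (grid a b n j))
        \<longlonglongrightarrow> (\<integral>t. indicator {a<..b} t *\<^sub>R \<phi> t \<partial>qmeas M v)"
proof -
  have "compact (\<phi> ` {a..b})"
    by (intro compact_continuous_image continuous_on_subset[OF \<phi>]) (use ab in auto)
  then obtain K where K: "\<And>t. t \<in> {a..b} \<Longrightarrow> norm (\<phi> t) \<le> K"
    by (metis bounded_iff compact_imp_bounded imageI)
  have [measurable]: "\<phi> \<in> borel_measurable (qmeas M v)" "{a<..b} \<in> sets (qmeas M v)"
    using ab by (auto intro: measurable_qmeas_continuous[OF \<phi>] simp: sets_qmeas_iff)
  have w: "integrable (qmeas M v) (\<lambda>t. indicator {a<..b} t *\<^sub>R K)"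
  proof (intro integrable_scaleR_left integrable_real_indicator)
    show "emeasure (qmeas M v) {a<..b} < \<infinity>"
      using emeasure_qmeas_bounded[OF M, of "{a<..b}" b v] ab by (simp add: subset_eq)
  qed simp
  show "integrable (qmeas M v) (\<lambda>t. indicator {a<..b} t *\<^sub>R \<phi> t)"
  proof (rule Bochner_Integration.integrable_bound[OF w])
    show "AE t in qmeas M v. norm (indicator {a<..b} t *\<^sub>R \<phi> t) \<le> norm (indicator {a<..b} t *\<^sub>R K)"
      using K by (intro AE_I2) (auto simp: indicator_def intro: order_trans[OF _ abs_ge_self])
  qed measurable
  \<comment> \<open>The shift to \<open>Suc n\<close> avoids \<open>n = 0\<close>, for which there
    are no cells and the mesh would divide by zero.\<close>
  let ?u = "\<lambda>n t. indicator {a<..b} t *\<^sub>R \<phi> (grid a b (Suc n) (cell_index a b (Suc n) t))"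
  have "(\<lambda>n. \<integral>t. ?u n t \<partial>qmeas M v) \<longlonglongrightarrow> (\<integral>t. indicator {a<..b} t *\<^sub>R \<phi> t \<partial>qmeas M v)"
  proof (rule integral_dominated_convergence[OF _ _ w])
    show "?u n \<in> borel_measurable (qmeas M v)" for n
      by (rule borel_measurable_integrable[OF integrable_cell_step[OF M ab]]) simp
    show "AE t in qmeas M v. (\<lambda>n. ?u n t) \<longlonglongrightarrow> indicator {a<..b} t *\<^sub>R \<phi> t"
    proof (rule AE_I2)
      fix t
      show "(\<lambda>n. ?u n t) \<longlonglongrightarrow> indicator {a<..b} t *\<^sub>R \<phi> t"
        using LIMSEQ_Suc[OF cell_step_LIMSEQ[OF \<phi> ab, of t]] by (cases "t \<in> {a<..b}") auto
    qed
    show "AE t in qmeas M v. norm (?u n t) \<le> indicator {a<..b} t *\<^sub>R K" for n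
    proof (rule AE_I2)
      fix t
      have "norm (\<phi> (grid a b (Suc n) (cell_index a b (Suc n) t))) \<le> K" if "t \<in> {a<..b}"
        using grid_bounds[OF less_imp_le[OF ab(2)] cell_index_in[OF ab(2) zero_less_Suc that, of n]] by (intro K) auto
      then show "norm (?u n t) \<le> indicator {a<..b} t *\<^sub>R K" by (auto simp: indicator_def)
    qed
  qed measurable
  then show "(\<lambda>n. \<Sum>j\<in>{1..n}. qform M v (cell a b n j) *\<^sub>R \<phi> (grid a b n j))
        \<longlonglongrightarrow> (\<integral>t. indicator {a<..b} t *\<^sub>R \<phi> t \<partial>qmeas M v)"
    by (subst (asm) integral_cell_step[OF M ab]) (simp, rule LIMSEQ_imp_Suc)
qed

text \<open>With right endpoints as tags, the sum of a decreasing function is a lower sum. The bound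
  thus holds for every partition and not just in the limit.\<close>

lemma riemann_stieltjes_le_integral:
  fixes c :: "real \<Rightarrow> real"
  assumes M: "opmeasure M" and ab: "0 < a" "a < b"
    and c: "\<And>t. 0 < t \<Longrightarrow> 0 \<le> c t" "\<And>s t. 0 < s \<Longrightarrow> s \<le> t \<Longrightarrow> c t \<le> c s" "integrable (qmeas M v) c"
  shows "(\<Sum>j\<in>{1..n}. qform M v (cell a b n j) * c (grid a b n j)) \<le> (\<integral>t. c t \<partial>qmeas M v)"
proof (cases "n = 0")
  case True
  then show ?thesis using c(1) by (auto intro!: integral_nonneg_AE AE_I2)
next
  case False
  then have n: "0 < n" by simp
  have "(\<Sum>j\<in>{1..n}. qform M v (cell a b n j) * c (grid a b n j))
      = (\<integral>t. indicator {a<..b} t *\<^sub>R c (grid a b n (cell_index a b n t)) \<partial>qmeas M v)"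
    using integral_cell_step[OF M ab n, of v "\<lambda>j. c (grid a b n j)"] by simp
  also have "\<dots> \<le> (\<integral>t. c t \<partial>qmeas M v)"
  proof (rule integral_mono[OF integrable_cell_step[OF M ab n] c(3)])
    fix t assume "t \<in> space (qmeas M v)"
    then have t: "0 < t" by simp
    show "indicator {a<..b} t *\<^sub>R c (grid a b n (cell_index a b n t)) \<le> c t"
      using grid_cell_index(1)[OF ab(2) n, of t] c(1,2)[OF t] by (auto simp: indicator_def)
  qed
  finally show ?thesis .
qed

section \<open>Szego kernels\<close>

lemma
  fixes s :: real
  assumes s: "0 < s"
  shows integrable_poisson: "integrable lebesgue (\<lambda>x. 1 / (x\<^sup>2 + s\<^sup>2))"
    and integral_poisson: "(\<integral>x. 1 / (x\<^sup>2 + s\<^sup>2) \<partial>lebesgue) = pi / s"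
proof -
  have pos: "0 < x\<^sup>2 + s\<^sup>2" for x using s by (simp add: add_nonneg_pos)
  let ?F = "\<lambda>x. arctan (x / s) / s"
  have D: "(?F has_real_derivative 1 / (x\<^sup>2 + s\<^sup>2)) (at x)" for x
  proof -
    have e: "1 + (x / s)\<^sup>2 = (x\<^sup>2 + s\<^sup>2) / s\<^sup>2"
      using s by (simp add: power_divide field_simps)
    have "(?F has_real_derivative inverse (1 + (x / s)\<^sup>2) * (1 / s) / s) (at x)"
      by (intro DERIV_cdivide DERIV_chain2[OF DERIV_arctan] DERIV_ident)
    also have "inverse (1 + (x / s)\<^sup>2) * (1 / s) / s = 1 / (x\<^sup>2 + s\<^sup>2)"
      unfolding e using s by (simp add: power2_eq_square)
    finally show ?thesis .
  qed
  have c: "isCont (\<lambda>x. 1 / (x\<^sup>2 + s\<^sup>2)) x" for x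
    using pos[of x] by (intro continuous_intros) auto
  have "filterlim (\<lambda>x. x / s) at_bot at_bot"
    using filterlim_tendsto_pos_mult_at_bot[OF tendsto_const[of "1 / s"] _ filterlim_ident] s by simp
  then have lim1: "((?F \<circ> real_of_ereal) \<longlongrightarrow> (- (pi / 2)) / s) (at_right (-\<infinity>))"
    unfolding ereal_tendsto_simps using s
    by (intro tendsto_divide filterlim_compose[OF tendsto_arctan_at_bot] tendsto_const) auto
  have "filterlim (\<lambda>x. x / s) at_top at_top"
    using filterlim_tendsto_pos_mult_at_top[OF tendsto_const[of "1 / s"] _ filterlim_ident] s by simp
  then have lim2: "((?F \<circ> real_of_ereal) \<longlongrightarrow> (pi / 2) / s) (at_left \<infinity>)"
    unfolding ereal_tendsto_simps using s
    by (intro tendsto_divide filterlim_compose[OF tendsto_arctan_at_top] tendsto_const) auto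
  \<comment> \<open>For a nonnegative integrand, finite limits of the antiderivative at both ends
    give integrability together with the value.\<close>
  note FTC = interval_integral_FTC_nonneg[OF _ D c _ lim1 lim2]
  have i: "integrable lborel (\<lambda>x. 1 / (x\<^sup>2 + s\<^sup>2))"
    using FTC(1) by (simp add: set_integrable_def einterval_def)
  then show "integrable lebesgue (\<lambda>x. 1 / (x\<^sup>2 + s\<^sup>2))"
    by (simp add: integrable_completion)
  have "(\<integral>x. 1 / (x\<^sup>2 + s\<^sup>2) \<partial>lborel) = (pi / 2) / s - (- (pi / 2)) / s"
    using FTC(2) by (simp add: interval_lebesgue_integral_def set_lebesgue_integral_def einterval_def)
  then show "(\<integral>x. 1 / (x\<^sup>2 + s\<^sup>2) \<partial>lebesgue) = pi / s"
    using borel_measurable_integrable[OF i] s by (simp add: integral_completion field_simps)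
qed

lemma L2fun_continuous:
  fixes f :: "real \<Rightarrow> 'a::chilbert"
  assumes f: "continuous_on UNIV f" and i: "integrable lebesgue (\<lambda>x. (norm (f x))\<^sup>2)"
  shows "L2fun f"
  unfolding L2fun_def
proof (intro conjI exI)
  show "f \<in> borel_measurable lebesgue"
    using borel_measurable_continuous_onI[OF f] by (simp add: measurable_completion)
  \<comment> \<open>By continuity the values at the rationals are dense in the range, so they
    witness its separability.\<close>
  show "countable (f ` \<rat>)" by (simp add: countable_rat)
  have "f ` closure \<rat> \<subseteq> closure (f ` \<rat>)"
    by (intro image_closure_subset continuous_on_subset[OF f] closure_subset) auto
  moreover have "x \<in> closure \<rat>" for x :: real
    unfolding closure_approachable
  proof (intro allI impI)
    fix e :: real assume "0 < e"
    then obtain r where "r \<in> \<rat>" "x < r" "r < x + e"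
      using Rats_dense_in_real[of x "x + e"] by auto
    then show "\<exists>r\<in>\<rat>. dist r x < e"
      by (intro bexI[of _ r]) (auto simp: dist_real_def)
  qed
  ultimately show "AE x in lebesgue. f x \<in> closure (f ` \<rat>)"
    by (intro AE_I2) auto
qed (rule i)

text \<open>Up to a scalar factor this is the reproducing kernel of the Hardy space at
  \<open>\<i> * s\<close>, times \<open>v\<close>. At \<open>\<i> * t\<close> with
  \<open>t > 0\<close> its norm is \<open>norm v / (t + s)\<close>.\<close>

definition szego :: "real \<Rightarrow> 'a::chilbert \<Rightarrow> complex \<Rightarrow> 'a" where
  "szego s v z = cscale (1 / (z + \<i> * complex_of_real s)) v"

lemma norm_szego: "(norm (szego s v (Complex x y)))\<^sup>2 = 1 / (x\<^sup>2 + (y + s)\<^sup>2) * (norm v)\<^sup>2"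
  unfolding szego_def norm_cscale norm_divide power_mult_distrib power_divide cmod_power2 by simp

lemma L2fun_szego:
  assumes s: "0 < y + s"
  shows "L2fun (\<lambda>x. szego s v (Complex x y))"
proof (rule L2fun_continuous)
  have "Complex x y + \<i> * complex_of_real s \<noteq> 0" for x
    using s by (simp add: complex_eq_iff)
  then have "continuous_on UNIV (\<lambda>x. szego s v (Complex x y))"
    unfolding szego_def by (intro cscale.continuous_on continuous_intros) auto
  then show "continuous_on UNIV (\<lambda>x. szego s v (Complex x y))" .
  show "integrable lebesgue (\<lambda>x. (norm (szego s v (Complex x y)))\<^sup>2)"
    unfolding norm_szego by (intro integrable_mult_left integrable_poisson s)
qed

lemma hardy2_szego:
  fixes v :: "'a::chilbert"
  assumes s: "0 < s"
  shows "hardy2 (szego s v) (\<lambda>x. szego s v (Complex x 0))"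
  unfolding hardy2_def
proof (intro conjI allI impI)
  fix z :: complex assume z: "0 < Im z"
  then have nz: "z + \<i> * complex_of_real s \<noteq> 0"
    using s by (auto simp: complex_eq_iff)
  have "((\<lambda>z. 1 / (z + \<i> * complex_of_real s)) has_field_derivative - 1 / (z + \<i> * complex_of_real s)\<^sup>2) (at z)"
    by (rule derivative_eq_intros refl | simp add: nz power2_eq_square)+
  then have "((\<lambda>z. szego s v z) has_derivative (\<lambda>h. cscale (- 1 / (z + \<i> * complex_of_real s)\<^sup>2 * h) v)) (at z)"
    unfolding szego_def has_field_derivative_def
    by (rule bounded_linear.has_derivative[OF cscale.bounded_linear_left])
  moreover have "cscale (- 1 / (z + \<i> * complex_of_real s)\<^sup>2 * h) v
      = cscale h (cscale (- 1 / (z + \<i> * complex_of_real s)\<^sup>2) v)" for h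
    by (simp add: cscale_mult[symmetric] mult.commute)
  ultimately show "\<exists>D. (szego s v has_derivative (\<lambda>h. cscale h D)) (at z)"
    by (intro exI[of _ "cscale (- 1 / (z + \<i> * complex_of_real s)\<^sup>2) v"]) (simp only:)
next
  have "(\<integral>x. (norm (szego s v (Complex x y)))\<^sup>2 \<partial>lebesgue) \<le> pi / s * (norm v)\<^sup>2" if y: "0 < y" for y
  proof -
    have "pi / (y + s) \<le> pi / s" using y s by (intro divide_left_mono) auto
    moreover have "(\<integral>x. (norm (szego s v (Complex x y)))\<^sup>2 \<partial>lebesgue) = pi / (y + s) * (norm v)\<^sup>2"
      using y s by (simp only: norm_szego integral_mult_left_zero integral_poisson add_pos_pos)
    ultimately show ?thesis
      by (simp only: mult_right_mono zero_le_power2)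
  qed
  then show "\<exists>C. \<forall>y>0. L2fun (\<lambda>x. szego s v (Complex x y))
      \<and> (\<integral>x. (norm (szego s v (Complex x y)))\<^sup>2 \<partial>lebesgue) \<le> C"
    using s by (intro exI[of _ "pi / s * (norm v)\<^sup>2"] allI impI conjI L2fun_szego) auto
next
  show "L2fun (\<lambda>x. szego s v (Complex x 0))"
    using s by (intro L2fun_szego) auto
next
  let ?I = "\<lambda>y. \<integral>x. (norm (szego s v (Complex x y) - szego s v (Complex x 0)))\<^sup>2 \<partial>lebesgue"
  \<comment> \<open>Resolvent identity: the difference of the two reciprocals is
    \<open>(q - p) / (p * q)\<close>. The factor \<open>p\<close> is estimated by
    \<open>cmod p \<ge> s\<close>, while \<open>q\<close> is kept to supply an integrable weight
    independent of \<open>y\<close>.\<close>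
  have le: "(norm (szego s v (Complex x y) - szego s v (Complex x 0)))\<^sup>2
      \<le> y\<^sup>2 * ((norm v)\<^sup>2 / s\<^sup>2) * (1 / (x\<^sup>2 + s\<^sup>2))" if y: "0 < y" for x y
  proof -
    define p q where "p = Complex x y + \<i> * complex_of_real s" and "q = Complex x 0 + \<i> * complex_of_real s"
    have nz: "p \<noteq> 0" "q \<noteq> 0" using y s by (auto simp: p_def q_def complex_eq_iff)
    have "1 / p - 1 / q = (q - p) / (p * q)" using nz by (simp add: field_simps)
    moreover have "q - p = - (\<i> * complex_of_real y)" by (simp add: p_def q_def complex_eq_iff)
    ultimately have n: "cmod (1 / p - 1 / q) = y / (cmod p * cmod q)"
      using y by (simp add: norm_divide norm_mult)
    have q: "(cmod q)\<^sup>2 = x\<^sup>2 + s\<^sup>2" unfolding q_def cmod_power2 by simp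
    have "(cmod p)\<^sup>2 = x\<^sup>2 + (y + s)\<^sup>2" unfolding p_def cmod_power2 by simp
    moreover have "s\<^sup>2 \<le> (y + s)\<^sup>2" using y s by (intro power_mono) auto
    ultimately have p: "s\<^sup>2 \<le> (cmod p)\<^sup>2" by (smt (verit) zero_le_power2)
    have pos: "0 < s\<^sup>2" "0 < x\<^sup>2 + s\<^sup>2" using s by (simp_all add: add_nonneg_pos)
    have "(norm (szego s v (Complex x y) - szego s v (Complex x 0)))\<^sup>2 = y\<^sup>2 * (norm v)\<^sup>2 / ((cmod p)\<^sup>2 * (cmod q)\<^sup>2)"
      unfolding szego_def p_def[symmetric] q_def[symmetric] cscale.diff_left[symmetric] norm_cscale n
      by (simp add: power_divide power_mult_distrib)
    also have "\<dots> \<le> y\<^sup>2 * (norm v)\<^sup>2 / (s\<^sup>2 * (x\<^sup>2 + s\<^sup>2))"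
      unfolding q using p pos s by (intro divide_left_mono mult_right_mono mult_pos_pos) auto
    finally show ?thesis using s by (simp add: field_simps)
  qed
  have "?I y \<le> y\<^sup>2 * ((norm v)\<^sup>2 / s\<^sup>2) * (pi / s)" if y: "0 < y" for y
  proof -
    have "?I y \<le> (\<integral>x. y\<^sup>2 * ((norm v)\<^sup>2 / s\<^sup>2) * (1 / (x\<^sup>2 + s\<^sup>2)) \<partial>lebesgue)"
      by (intro integral_mono' integrable_mult_right integrable_poisson s le y) auto
    then show ?thesis by (simp only: integral_mult_right_zero integral_poisson[OF s])
  qed
  moreover have "((\<lambda>y. y\<^sup>2 * ((norm v)\<^sup>2 / s\<^sup>2) * (pi / s)) \<longlongrightarrow> 0) (at_right 0)"
    using s by (auto intro!: tendsto_eq_intros)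
  ultimately show "(?I \<longlongrightarrow> 0) (at_right 0)"
  proof (elim tendsto_sandwich[rotated 2, OF tendsto_const])
    show "\<forall>\<^sub>F y in at_right 0. 0 \<le> ?I y"
      by (intro always_eventually allI integral_nonneg_AE AE_I2) simp
  qed (rule eventually_mono[OF eventually_at_right_less])
qed

lemma l2norm_szego:
  assumes s: "0 < s"
  shows "l2norm (\<lambda>x. szego s v (Complex x 0)) * l2norm (\<lambda>x. szego s v (Complex x 0)) = pi / s * (norm v)\<^sup>2"
proof -
  have "(\<integral>x. (norm (szego s v (Complex x 0)))\<^sup>2 \<partial>lebesgue) = pi / s * (norm v)\<^sup>2"
    by (simp only: norm_szego integral_mult_left_zero add_0_left integral_poisson[OF s])
  then show ?thesis
    unfolding l2norm_def using s by simp
qed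

section \<open>Consequences of the Carleson condition\<close>

text \<open>The exhaustion in \<open>opint\<close> starts with the degenerate case of both endpoints
  equal to 1. The second \<open>Suc\<close> drops it, so that the lower end is always strictly below
  the upper one.\<close>

definition exh_lo :: "nat \<Rightarrow> real" where "exh_lo k = 1 / real (Suc (Suc k))"
definition exh_hi :: "nat \<Rightarrow> real" where "exh_hi k = real (Suc (Suc k))"

lemma exh_bounds: "0 < exh_lo k" "exh_lo k < exh_hi k"
proof -
  show "0 < exh_lo k" by (simp add: exh_lo_def)
  have "exh_lo k < 1" "1 < exh_hi k" by (simp_all add: exh_lo_def exh_hi_def)
  then show "exh_lo k < exh_hi k" by simp
qed

lemma exh_mono: "k \<le> l \<Longrightarrow> {exh_lo k<..exh_hi k} \<subseteq> {exh_lo l<..exh_hi l}"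
proof -
  assume kl: "k \<le> l"
  then have "exh_lo l \<le> exh_lo k" by (simp add: exh_lo_def frac_le)
  moreover have "exh_hi k \<le> exh_hi l" using kl by (simp add: exh_hi_def)
  ultimately show ?thesis by auto
qed

lemma exh_indicator_LIMSEQ:
  assumes "0 < (t::real)"
  shows "(\<lambda>k. indicator {exh_lo k<..exh_hi k} t :: real) \<longlonglongrightarrow> 1"
proof (rule tendsto_eventually)
  have "exh_lo \<longlonglongrightarrow> 0"
    unfolding exh_lo_def by (rule LIMSEQ_Suc[OF LIMSEQ_Suc[OF lim_1_over_n]])
  then have "\<forall>\<^sub>F k in sequentially. exh_lo k < t"
    using assms by (rule order_tendstoD)
  moreover have "\<forall>\<^sub>F k in sequentially. t \<le> exh_hi k"
    using eventually_ge_at_top[of "nat \<lceil>t\<rceil>"]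
    by eventually_elim (auto simp: exh_hi_def)
  ultimately show "\<forall>\<^sub>F k in sequentially. indicator {exh_lo k<..exh_hi k} t = (1::real)"
    by eventually_elim auto
qed

lemma opint_exh:
  assumes "opint M \<phi> \<psi> L"
  shows "(\<lambda>k. lim (rs_sum M \<phi> \<psi> (exh_lo k) (exh_hi k))) \<longlonglongrightarrow> L"
proof -
  have "(\<lambda>n. lim (rs_sum M \<phi> \<psi> (1 / real (Suc n)) (real (Suc n)))) \<longlonglongrightarrow> L"
    using assms unfolding opint_def by blast
  from LIMSEQ_Suc[OF this] show ?thesis
    unfolding exh_lo_def exh_hi_def .
qed

lemma continuous_on_inverse_square: "0 < (s::real) \<Longrightarrow> continuous_on {0<..} (\<lambda>t::real. 1 / (t + s)\<^sup>2)"
  by (intro continuous_intros) auto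

text \<open>Both slots carry multiples of the same vector \<open>v\<close>, so the operators enter
  only through \<open>qform M v\<close> and the scalars combine to a squared modulus.\<close>

lemma rs_sum_szego:
  assumes M: "opmeasure M" and s: "0 < s" and ab: "0 < a" "a < b"
  shows "rs_sum M (\<lambda>t. szego s v (\<i> * complex_of_real t)) (\<lambda>t. szego s v (\<i> * complex_of_real t)) a b n
    = complex_of_real (\<Sum>j\<in>{1..n}. qform M v (cell a b n j) *\<^sub>R (1 / (grid a b n j + s)\<^sup>2))"
proof -
  have "cinner (szego s v (\<i> * complex_of_real t)) (M A (szego s v (\<i> * complex_of_real t)))
      = complex_of_real (qform M v A *\<^sub>R (1 / (t + s)\<^sup>2))" if A: "pos_op (M A)" for t A
  proof -
    define c where "c = 1 / (\<i> * complex_of_real t + \<i> * complex_of_real s)"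
    have "cmod (\<i> * complex_of_real t + \<i> * complex_of_real s) = \<bar>t + s\<bar>"
      by (simp flip: distrib_left of_real_add add: norm_mult)
    then have "(cmod c)\<^sup>2 = 1 / (t + s)\<^sup>2"
      by (simp add: c_def norm_divide power_divide)
    then have "cnj c * c = complex_of_real (1 / (t + s)\<^sup>2)"
      by (metis complex_norm_square mult.commute of_real_power)
    moreover have "cinner (cscale c v) (M A (cscale c v)) = (cnj c * c) * cinner v (M A v)"
      by (simp add: pos_op_cscale[OF A] cinner_cscale_left cinner_cscale_right)
    moreover have "cinner v (M A v) = complex_of_real (qform M v A)"
      unfolding qform_def by (rule pos_op_cinner[OF A])
    ultimately show ?thesis
      unfolding szego_def c_def[symmetric] by simp
  qed
  moreover have "pos_op (M (cell a b n j))" if "j \<in> {1..n}" for j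
    using cell_subset[of a b j n] ab that by (intro opmeasure_pos_op[OF M, of _ b]) auto
  ultimately show ?thesis
    unfolding rs_sum_cells of_real_sum by (intro sum.cong refl) auto
qed

text \<open>Put the same kernel \<open>szego s v\<close> into both slots of the Carleson form. The
  form becomes the integral in question, and the product of the two norms is
  \<open>pi / s * (norm v)\<^sup>2\<close>, whence the factor \<open>1 / s\<close>.\<close>

lemma carleson_kernel_bound:
  assumes M: "carleson M"
  obtains C where "0 \<le> C"
    and "\<And>s v. 0 < s \<Longrightarrow> integrable (qmeas M v) (\<lambda>t. 1 / (t + s)\<^sup>2)"
    and "\<And>s v. 0 < s \<Longrightarrow> (\<integral>t. 1 / (t + s)\<^sup>2 \<partial>qmeas M v) \<le> C / s * (norm v)\<^sup>2"
proof -
  have M': "opmeasure M" using M by (simp add: carleson_def)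
  obtain C where C: "\<And>F f G g. hardy2 F f \<Longrightarrow> hardy2 G g \<Longrightarrow>
      \<exists>L. carleson_form M F G L \<and> cmod L \<le> C * l2norm f * l2norm g"
    using M unfolding carleson_def by blast
  \<comment> \<open>The constant of the Carleson condition has no prescribed sign, hence the
    absolute value.\<close>
  have main: "integrable (qmeas M v) (\<lambda>t. 1 / (t + s)\<^sup>2)
      \<and> (\<integral>t. 1 / (t + s)\<^sup>2 \<partial>qmeas M v) \<le> \<bar>C\<bar> * pi / s * (norm v)\<^sup>2" if s: "0 < s" for s v
  proof -
    let ?f = "\<lambda>t. szego s v (\<i> * complex_of_real t)"
    let ?w = "\<lambda>t. 1 / (t + s)\<^sup>2"
    let ?J = "\<lambda>k t. indicator {exh_lo k<..exh_hi k} t *\<^sub>R ?w t"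
    obtain L where L: "opint M ?f ?f L"
        "cmod L \<le> C * l2norm (\<lambda>x. szego s v (Complex x 0)) * l2norm (\<lambda>x. szego s v (Complex x 0))"
      using C[OF hardy2_szego[OF s, of v] hardy2_szego[OF s, of v]] unfolding carleson_form_def by blast
    note exh = exh_bounds
    have "lim (rs_sum M ?f ?f (exh_lo k) (exh_hi k)) = complex_of_real (\<integral>t. ?J k t \<partial>qmeas M v)" for k
    proof (rule limI)
      show "rs_sum M ?f ?f (exh_lo k) (exh_hi k) \<longlonglongrightarrow> complex_of_real (\<integral>t. ?J k t \<partial>qmeas M v)"
        unfolding rs_sum_szego[OF M' s exh]
        by (intro tendsto_of_real riemann_stieltjes_qmeas M' exh continuous_on_inverse_square s)
    qed
    then have "(\<lambda>k. complex_of_real (\<integral>t. ?J k t \<partial>qmeas M v)) \<longlonglongrightarrow> L"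
      using opint_exh[OF L(1)] by simp
    then have lim: "(\<lambda>k. \<integral>t. ?J k t \<partial>qmeas M v) \<longlonglongrightarrow> Re L"
      using tendsto_Re by fastforce
    \<comment> \<open>Monotone convergence along the exhaustion yields integrability over the
      half-line as well as the value, because the truncated integrals are known to converge.\<close>
    have conv: "integrable (qmeas M v) ?w" "(\<integral>t. ?w t \<partial>qmeas M v) = Re L"
    proof -
      have i: "integrable (qmeas M v) (?J k)" for k
        by (intro integrable_qmeas_interval M' exh continuous_on_inverse_square s)
      have mono: "AE t in qmeas M v. mono (\<lambda>k. ?J k t)"
      proof (intro AE_I2 monoI scaleR_right_mono)
        fix t :: real and k l :: nat assume "k \<le> l"
        then show "indicator {exh_lo k<..exh_hi k} t \<le> (indicator {exh_lo l<..exh_hi l} t :: real)"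
          by (intro indicator_leI) (rule subsetD[OF exh_mono])
      qed simp
      have nn: "AE t in qmeas M v. 0 \<le> ?J k t" for k
        by (intro AE_I2) auto
      have l: "AE t in qmeas M v. (\<lambda>k. ?J k t) \<longlonglongrightarrow> ?w t"
      proof (rule AE_I2)
        fix t assume "t \<in> space (qmeas M v)"
        then have "(\<lambda>k. ?J k t) \<longlonglongrightarrow> 1 *\<^sub>R ?w t"
          by (intro tendsto_intros exh_indicator_LIMSEQ) simp
        then show "(\<lambda>k. ?J k t) \<longlonglongrightarrow> ?w t" by simp
      qed
      have m: "?w \<in> borel_measurable (qmeas M v)"
        by (rule measurable_qmeas_continuous[OF continuous_on_inverse_square[OF s]])
      show "integrable (qmeas M v) ?w" "(\<integral>t. ?w t \<partial>qmeas M v) = Re L"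
        by (rule integral_monotone_convergence_nonneg[OF i mono nn l lim m])+
    qed
    have "Re L \<le> C * (pi / s * (norm v)\<^sup>2)"
      using L(2) complex_Re_le_cmod[of L] unfolding l2norm_szego[OF s, symmetric] by (simp add: mult.assoc)
    also have "\<dots> \<le> \<bar>C\<bar> * (pi / s * (norm v)\<^sup>2)"
      using s by (intro mult_right_mono) auto
    finally show ?thesis using conv by simp
  qed
  show ?thesis
    by (rule that[of "\<bar>C\<bar> * pi"]) (use main in auto)
qed

section \<open>Poisson bounds and integrability of the kernel of \<open>Nmu\<close>\<close>

lemma poisson_le_inverse_square:
  assumes "x \<noteq> (0::real)" "0 < t"
  shows "1 / (t\<^sup>2 + x\<^sup>2) \<le> 2 * (1 / (t + \<bar>x\<bar>)\<^sup>2)"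
proof -
  have "(t + \<bar>x\<bar>)\<^sup>2 \<le> 2 * (t\<^sup>2 + x\<^sup>2)"
    using sum_squares_bound[of t "\<bar>x\<bar>"] by (simp add: power2_sum)
  moreover have "0 < (t + \<bar>x\<bar>)\<^sup>2" "0 < t\<^sup>2 + x\<^sup>2"
    using assms by (auto simp: add_pos_nonneg)
  ultimately show ?thesis by (simp add: field_simps)
qed

lemma continuous_on_poisson:
  fixes x :: real
  shows "continuous_on {0<..} (\<lambda>t. x / (t\<^sup>2 + x\<^sup>2))"
  by (intro continuous_intros) (auto simp: add_nonneg_eq_0_iff)

text \<open>Choosing \<open>s = \<bar>x\<bar>\<close> in the Szego estimate, the numerator
  \<open>\<bar>x\<bar>\<close> cancels the factor \<open>1 / s\<close>, so the bound no longer
  depends on \<open>x\<close>. The factor 2 is that of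
  \<open>poisson_le_inverse_square\<close>.\<close>

lemma carleson_poisson_bound:
  assumes M: "carleson M"
  obtains C where "0 \<le> C"
    and "\<And>x v. integrable (qmeas M v) (\<lambda>t. \<bar>x\<bar> / (t\<^sup>2 + x\<^sup>2))"
    and "\<And>x v. (\<integral>t. \<bar>x\<bar> / (t\<^sup>2 + x\<^sup>2) \<partial>qmeas M v) \<le> C * (norm v)\<^sup>2"
proof -
  obtain C where C: "0 \<le> C"
    "\<And>s v. 0 < s \<Longrightarrow> integrable (qmeas M v) (\<lambda>t. 1 / (t + s)\<^sup>2)"
    "\<And>s v. 0 < s \<Longrightarrow> (\<integral>t. 1 / (t + s)\<^sup>2 \<partial>qmeas M v) \<le> C / s * (norm v)\<^sup>2"
    using carleson_kernel_bound[OF M] by blast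
  have "integrable (qmeas M v) (\<lambda>t. \<bar>x\<bar> / (t\<^sup>2 + x\<^sup>2))
      \<and> (\<integral>t. \<bar>x\<bar> / (t\<^sup>2 + x\<^sup>2) \<partial>qmeas M v) \<le> 2 * C * (norm v)\<^sup>2" for x v
  proof (cases "x = 0")
    case True
    then show ?thesis using C(1) by simp
  next
    case False
    let ?w = "\<lambda>t. 2 * \<bar>x\<bar> * (1 / (t + \<bar>x\<bar>)\<^sup>2)"
    have w: "integrable (qmeas M v) ?w"
      using C(2)[of "\<bar>x\<bar>" v] False by (intro integrable_mult_right) auto
    have le: "\<bar>x\<bar> / (t\<^sup>2 + x\<^sup>2) \<le> ?w t" if "0 < t" for t
      using mult_left_mono[OF poisson_le_inverse_square[OF False that], of "\<bar>x\<bar>"] by (simp add: mult.commute)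
    have i: "integrable (qmeas M v) (\<lambda>t. \<bar>x\<bar> / (t\<^sup>2 + x\<^sup>2))"
    proof (rule Bochner_Integration.integrable_bound[OF w])
      show "(\<lambda>t. \<bar>x\<bar> / (t\<^sup>2 + x\<^sup>2)) \<in> borel_measurable (qmeas M v)"
        using measurable_qmeas_continuous[OF continuous_on_poisson[of "\<bar>x\<bar>"]] by simp
      show "AE t in qmeas M v. norm (\<bar>x\<bar> / (t\<^sup>2 + x\<^sup>2)) \<le> norm (?w t)"
        by (intro AE_I2) (use le in \<open>simp add: order_trans[OF _ abs_ge_self]\<close>)
    qed
    have "(\<integral>t. \<bar>x\<bar> / (t\<^sup>2 + x\<^sup>2) \<partial>qmeas M v) \<le> (\<integral>t. ?w t \<partial>qmeas M v)"
      by (intro integral_mono i w le) simp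
    also have "\<dots> = 2 * \<bar>x\<bar> * (\<integral>t. 1 / (t + \<bar>x\<bar>)\<^sup>2 \<partial>qmeas M v)"
      by (rule integral_mult_right_zero)
    also have "\<dots> \<le> 2 * \<bar>x\<bar> * (C / \<bar>x\<bar> * (norm v)\<^sup>2)"
      using False by (intro mult_left_mono C(3)) auto
    also have "\<dots> = 2 * C * (norm v)\<^sup>2" using False by simp
    finally show ?thesis using i by simp
  qed
  then show ?thesis using C(1) by (intro that[of "2 * C"]) auto
qed

lemma continuous_on_nkernel:
  assumes "x \<noteq> (0::real)"
  shows "continuous_on {0<..} (nkernel (complex_of_real x))"
  unfolding nkernel_def
  by (intro continuous_intros) (use assms in \<open>auto simp: complex_eq_iff add_nonneg_eq_0_iff\<close>)

text \<open>The subtracted term removes the slowly decaying part. Over a common denominator the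
  numerator collapses to \<open>1 + \<i> * x * t\<close>, and this is controlled by
  \<open>cmod p\<close> because \<open>cmod p\<close> dominates both \<open>t\<close> and
  \<open>\<bar>x\<bar>\<close>.\<close>

lemma norm_nkernel_le:
  assumes x: "x \<noteq> (0::real)" and t: "0 < t"
  shows "cmod (nkernel (complex_of_real x) t) \<le> (1 + \<bar>x\<bar>) * (1 + 1 / \<bar>x\<bar>) * (1 / (1 + t\<^sup>2))"
proof -
  define p where "p = complex_of_real t - \<i> * complex_of_real x"
  have nz: "p \<noteq> 0" using x by (simp add: p_def complex_eq_iff)
  have pos: "0 < 1 + t\<^sup>2" by (simp add: add_pos_nonneg)
  then have nz': "complex_of_real (1 + t\<^sup>2) \<noteq> 0" by (simp only: of_real_eq_0_iff)
  have "nkernel (complex_of_real x) t = (complex_of_real (1 + t\<^sup>2) - complex_of_real t * p) / (p * complex_of_real (1 + t\<^sup>2))"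
    unfolding nkernel_def p_def[symmetric] of_real_divide diff_frac_eq[OF nz nz'] mult_1 ..
  also have "complex_of_real (1 + t\<^sup>2) - complex_of_real t * p = 1 + \<i> * complex_of_real (x * t)"
    by (simp add: p_def complex_eq_iff power2_eq_square)
  finally have "cmod (nkernel (complex_of_real x) t)
      = cmod (1 + \<i> * complex_of_real (x * t)) / cmod p * (1 / (1 + t\<^sup>2))"
    using pos by (simp only: norm_divide norm_mult norm_of_real) simp
  moreover have "cmod (1 + \<i> * complex_of_real (x * t)) \<le> 1 + \<bar>x\<bar> * t"
    using norm_triangle_ineq[of 1 "\<i> * complex_of_real (x * t)"] t by (simp add: norm_mult abs_mult)
  moreover have "1 + \<bar>x\<bar> * t \<le> (1 + \<bar>x\<bar>) * (1 + 1 / \<bar>x\<bar>) * cmod p"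
  proof -
    have "t \<le> cmod p" "\<bar>x\<bar> \<le> cmod p"
      using abs_Re_le_cmod[of p] abs_Im_le_cmod[of p] t by (auto simp: p_def)
    then have "1 \<le> 1 / \<bar>x\<bar> * cmod p" "\<bar>x\<bar> * t \<le> \<bar>x\<bar> * cmod p"
      using x by (auto simp: field_simps intro: mult_left_mono)
    then have "1 + \<bar>x\<bar> * t \<le> (1 / \<bar>x\<bar> + \<bar>x\<bar>) * cmod p" by (simp add: distrib_right)
    also have "\<dots> \<le> (1 + \<bar>x\<bar>) * (1 + 1 / \<bar>x\<bar>) * cmod p"
    proof (rule mult_right_mono)
      have "(1 + \<bar>x\<bar>) * (1 + 1 / \<bar>x\<bar>) = 1 / \<bar>x\<bar> + \<bar>x\<bar> + 2"
        using x by (simp add: field_simps)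
      then show "1 / \<bar>x\<bar> + \<bar>x\<bar> \<le> (1 + \<bar>x\<bar>) * (1 + 1 / \<bar>x\<bar>)" by simp
    qed simp
    finally show ?thesis .
  qed
  ultimately show ?thesis
    using nz pos by (auto intro!: divide_right_mono simp: pos_divide_le_eq)
qed

lemma integrable_nkernel:
  assumes M: "carleson M" and x: "x \<noteq> 0"
  shows "integrable (qmeas M v) (nkernel (complex_of_real x))"
proof -
  obtain C where "\<And>x v. integrable (qmeas M v) (\<lambda>t. \<bar>x\<bar> / (t\<^sup>2 + x\<^sup>2))"
    using carleson_poisson_bound[OF M] by blast
  \<comment> \<open>The Poisson bound at abscissa 1 is the integrability of
    \<open>1 / (1 + t\<^sup>2)\<close>, which dominates the kernel for every nonzero
    \<open>x\<close>.\<close>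
  from this[of v 1] have "integrable (qmeas M v) (\<lambda>t. 1 / (1 + t\<^sup>2))"
    by (simp add: add.commute)
  then have w: "integrable (qmeas M v) (\<lambda>t. (1 + \<bar>x\<bar>) * (1 + 1 / \<bar>x\<bar>) * (1 / (1 + t\<^sup>2)))"
    by (rule integrable_mult_right)
  show ?thesis
  proof (rule Bochner_Integration.integrable_bound[OF w])
    show "nkernel (complex_of_real x) \<in> borel_measurable (qmeas M v)"
      by (rule measurable_qmeas_continuous[OF continuous_on_nkernel[OF x]])
    show "AE t in qmeas M v. norm (nkernel (complex_of_real x) t)
        \<le> norm ((1 + \<bar>x\<bar>) * (1 + 1 / \<bar>x\<bar>) * (1 / (1 + t\<^sup>2)))"
    proof (rule AE_I2)
      fix t assume "t \<in> space (qmeas M v)"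
      then have "norm (nkernel (complex_of_real x) t) \<le> (1 + \<bar>x\<bar>) * (1 + 1 / \<bar>x\<bar>) * (1 / (1 + t\<^sup>2))"
        by (intro norm_nkernel_le[OF x]) simp
      then show "norm (nkernel (complex_of_real x) t) \<le> norm ((1 + \<bar>x\<bar>) * (1 + 1 / \<bar>x\<bar>) * (1 / (1 + t\<^sup>2)))"
        unfolding real_norm_def by (rule order_trans) (rule abs_ge_self)
    qed
  qed
qed

section \<open>Contour integrals over rectangles\<close>

lemma contour_integral_linepath_same_Im:
  assumes "Im z = c" "Im z' = c" "Re z = a" "Re z' = b" "a < b"
  shows "contour_integral (linepath z z') f = integral {a..b} (\<lambda>x. f (Complex x c))"
proof -
  have zz': "z = Complex a c" "z' = Complex b c"
    using assms by (auto simp: complex_eq_iff)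
  have "contour_integral (linepath z z') f = (z' - z) * integral {0..1} (\<lambda>x. f (linepath z z' x))"
    by (simp add: contour_integral_integral)
  also have "z' - z = of_real (b - a)"
    by (simp add: zz' Complex_eq algebra_simps)
  also have "integral {0..1} (\<lambda>x. f (linepath z z' x)) =
      integral {0..1} (\<lambda>x. f (Complex (linepath a b x) c))"
    by (simp add: linepath_def Complex_eq scaleR_conv_of_real algebra_simps zz')
  also have "\<dots> = integral {0..(b - a) / (b - a)} (\<lambda>x. f (Complex (a + (b - a) * x) c))"
    using \<open>a < b\<close> by (simp add: algebra_simps linepath_def)
  also have "{0..(b - a) / (b - a)} = (\<lambda>x. x / (b - a)) ` {0..b - a}"
    using \<open>a < b\<close> by simp
  also have "integral \<dots> (\<lambda>x. f (Complex (a + (b - a) * x) c)) =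
      integral {a-a..b-a} (\<lambda>x. f (Complex (x + a) c)) / of_real (b - a)"
    using \<open>a < b\<close> by (subst integral_stretch_real) (auto simp: scaleR_conv_of_real add_ac)
  also have "\<dots> = integral {a..b} (\<lambda>x. f (Complex x c)) / of_real (b - a)"
    by (subst integral_shift_real_ivl) (rule refl)
  finally show ?thesis
    using \<open>a < b\<close> by simp
qed

lemma contour_integral_rectpath:
  assumes f: "continuous_on (path_image (rectpath (Complex a c) (Complex b d))) f"
    and ab: "a < b" and cd: "c < d"
  shows "contour_integral (rectpath (Complex a c) (Complex b d)) f =
    integral {a..b} (\<lambda>x. f (Complex x c)) - integral {a..b} (\<lambda>x. f (Complex x d))
    + \<i> * (integral {c..d} (\<lambda>s. f (Complex b s)) - integral {c..d} (\<lambda>s. f (Complex a s)))"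
proof -
  let ?p = "Complex a c" and ?q = "Complex b c" and ?r = "Complex b d" and ?s = "Complex a d"
  have img: "path_image (rectpath ?p ?r) = closed_segment ?p ?q \<union> closed_segment ?q ?r
      \<union> closed_segment ?r ?s \<union> closed_segment ?s ?p"
    unfolding rectpath_def Let_def by (simp add: path_image_join Un_assoc)
  have c: "f contour_integrable_on linepath ?p ?q" "f contour_integrable_on linepath ?q ?r"
      "f contour_integrable_on linepath ?r ?s" "f contour_integrable_on linepath ?s ?p"
      "continuous_on (closed_segment ?r ?s) f" "continuous_on (closed_segment ?s ?p) f"
    by (auto intro!: contour_integrable_continuous_linepath continuous_on_subset[OF f] simp: img)
  have "contour_integral (rectpath ?p ?r) f = contour_integral (linepath ?p ?q) f
      + contour_integral (linepath ?q ?r) f + contour_integral (linepath ?r ?s) f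
      + contour_integral (linepath ?s ?p) f"
    unfolding rectpath_def Let_def using c
    by (simp add: contour_integrable_joinI contour_integral_join algebra_simps)
  also have "contour_integral (linepath ?r ?s) f = - contour_integral (linepath ?s ?r) f"
    using contour_integral_reverse_linepath[OF c(5)] by simp
  also have "contour_integral (linepath ?s ?p) f = - contour_integral (linepath ?p ?s) f"
    using contour_integral_reverse_linepath[OF c(6)] by simp
  also have "contour_integral (linepath ?p ?q) f = integral {a..b} (\<lambda>x. f (Complex x c))"
    by (rule contour_integral_linepath_same_Im) (use ab in auto)
  also have "contour_integral (linepath ?s ?r) f = integral {a..b} (\<lambda>x. f (Complex x d))"
    by (rule contour_integral_linepath_same_Im) (use ab in auto)
  also have "contour_integral (linepath ?q ?r) f = \<i> * integral {c..d} (\<lambda>s. f (Complex b s))"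
    by (rule contour_integral_linepath_same_Re) (use cd in auto)
  also have "contour_integral (linepath ?p ?s) f = \<i> * integral {c..d} (\<lambda>s. f (Complex a s))"
    by (rule contour_integral_linepath_same_Re) (use cd in auto)
  finally show ?thesis by (simp add: algebra_simps)
qed

text \<open>By Tonelli the vertical integrals are an integrable function of the abscissa, so they cannot
  stay away from zero.\<close>

lemma small_vertical_integrals:
  fixes h :: "real \<Rightarrow> real \<Rightarrow> real"
  assumes h: "continuous_on (UNIV \<times> {c..d}) (\<lambda>p. h (fst p) (snd p))"
    and nn: "\<And>x s. 0 \<le> h x s"
    and K: "\<And>s. s \<in> {c..d} \<Longrightarrow> (\<integral>\<^sup>+x. ennreal (h x s) \<partial>lborel) \<le> ennreal K"
    and e: "0 < e"
  shows "\<exists>R\<ge>N. integral {c..d} (h R) + integral {c..d} (h (- R)) \<le> e"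
proof (rule ccontr)
  assume "\<not> ?thesis"
  then have big: "e \<le> integral {c..d} (h R) + integral {c..d} (h (- R))" if "N \<le> R" for R
    using that by force
  let ?S = "UNIV \<times> {c..d} :: (real \<times> real) set"
  let ?g = "\<lambda>x s. ennreal (indicator ?S (x, s) *\<^sub>R h x s)"
  define U where "U x = (\<integral>\<^sup>+s. ?g x s \<partial>lborel)" for x
  \<comment> \<open>Continuity is given on the closed strip only. Cutting off with the indicator
    makes the integrand jointly Borel on the whole plane, as Tonelli requires.\<close>
  have "(\<lambda>p. indicator ?S p *\<^sub>R h (fst p) (snd p)) \<in> borel_measurable borel"
    by (intro borel_measurable_continuous_on_indicator h borel_closed closed_Times) auto
  then have "(\<lambda>p. ennreal (indicator ?S p *\<^sub>R h (fst p) (snd p))) \<in> borel_measurable borel"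
    by (rule measurable_compose[OF _ measurable_ennreal])
  moreover have "(\<lambda>(x, s). ?g x s) = (\<lambda>p. ennreal (indicator ?S p *\<^sub>R h (fst p) (snd p)))"
    by (simp only: case_prod_unfold prod.collapse)
  ultimately have gm: "(\<lambda>(x, s). ?g x s) \<in> borel_measurable (lborel \<Otimes>\<^sub>M lborel)"
    by (simp add: lborel_prod)
  have hi: "h x integrable_on {c..d}" for x
  proof -
    have "continuous_on {c..d} (\<lambda>s. h (fst (x, s)) (snd (x, s)))"
      by (rule continuous_on_compose2[OF h, of "{c..d}" "\<lambda>s. (x, s)"])
        (auto intro!: continuous_intros)
    then show ?thesis by (intro integrable_continuous_real) simp
  qed
  have U: "U x = ennreal (integral {c..d} (h x))" for x
  proof -
    have "integral\<^sup>N lborel (\<lambda>s. indicator {c..d} s * h x s) = ennreal (integral {c..d} (h x))"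
      by (intro nn_integral_has_integral_lebesgue nn integrable_integral hi)
    moreover have "indicator {c..d} s * h x s = indicator ?S (x, s) *\<^sub>R h x s" for s
      by (simp add: indicator_def)
    ultimately show ?thesis unfolding U_def by simp
  qed
  have Um [measurable]: "U \<in> borel_measurable lborel"
    using lborel.borel_measurable_nn_integral_fst[OF gm] by (simp add: U_def[abs_def])
  have nonneg: "0 \<le> integral {c..d} (h x)" for x
    by (intro Henstock_Kurzweil_Integration.integral_nonneg hi nn)
  have "(\<integral>\<^sup>+x. U x \<partial>lborel) = (\<integral>\<^sup>+s. (\<integral>\<^sup>+x. ?g x s \<partial>lborel) \<partial>lborel)"
    unfolding U_def by (rule lborel_pair.Fubini'[symmetric]) (rule gm)
  also have "\<dots> \<le> (\<integral>\<^sup>+s. ennreal K * indicator {c..d} s \<partial>lborel)"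
  proof (rule nn_integral_mono)
    fix s
    show "(\<integral>\<^sup>+x. ?g x s \<partial>lborel) \<le> ennreal K * indicator {c..d} s"
      using K[of s] by (cases "s \<in> {c..d}") auto
  qed
  also have "\<dots> = ennreal K * emeasure lborel {c..d}"
    by (simp add: nn_integral_cmult_indicator)
  also have "\<dots> < \<infinity>"
    by (simp add: ennreal_mult_less_top emeasure_lborel_Icc_eq)
  finally have fin: "(\<integral>\<^sup>+x. U x \<partial>lborel) < \<infinity>" .
  have "(\<integral>\<^sup>+x. U (- x) \<partial>lborel) = (\<integral>\<^sup>+x. U x \<partial>lborel)"
    using nn_integral_real_affine[of U "-1" 0] by simp
  then have "(\<integral>\<^sup>+x. U x + U (- x) \<partial>lborel) < \<infinity>"
    using fin by (simp add: nn_integral_add)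
  \<comment> \<open>If the claim failed, \<open>U x + U (- x)\<close> would be at least
    \<open>e\<close> on a half-line of infinite measure, against the finiteness of its
    integral.\<close>
  moreover have "(\<integral>\<^sup>+x. ennreal e * indicator {N..} x \<partial>lborel) \<le> (\<integral>\<^sup>+x. U x + U (- x) \<partial>lborel)"
  proof (rule nn_integral_mono)
    fix x
    show "ennreal e * indicator {N..} x \<le> U x + U (- x)"
      using big[of x] unfolding U
      by (auto simp: indicator_def nonneg simp flip: ennreal_plus intro: ennreal_leI)
  qed
  moreover have "emeasure lborel {N..} = \<infinity>"
  proof (rule ccontr)
    assume "emeasure lborel {N..} \<noteq> \<infinity>"
    then obtain n :: nat where n: "emeasure lborel {N..} < of_nat n"
      using ennreal_Ex_less_of_nat[of "emeasure lborel {N..}"] by (auto simp: less_top)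
    have "of_nat n = emeasure lborel {N..N + real n}"
      by (simp add: emeasure_lborel_Icc_eq ennreal_of_nat_eq_real_of_nat)
    also have "\<dots> \<le> emeasure lborel {N..}"
      by (rule emeasure_mono) auto
    finally show False using n by simp
  qed
  then have "(\<integral>\<^sup>+x. ennreal e * indicator {N..} x \<partial>lborel) = \<infinity>"
    using e by (simp add: nn_integral_cmult_indicator ennreal_mult_top)
  ultimately show False by simp
qed

section \<open>Cauchy's formula in the half-plane\<close>

lemma integrable_lebesgue_truncation_LIMSEQ:
  fixes q :: "real \<Rightarrow> complex"
  assumes q: "integrable lebesgue q"
  shows "((\<lambda>R. integral {-R..R} q) \<longlongrightarrow> (\<integral>x. q x \<partial>lebesgue)) at_top"
proof -
  have e: "integral {-R..R} q = (\<integral>x. indicator {-R..R} x *\<^sub>R q x \<partial>lebesgue)" for R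
  proof -
    have "set_integrable lebesgue {-R..R} q"
      unfolding set_integrable_def by (rule integrable_mult_indicator[OF _ q]) simp
    then show ?thesis
      using set_lebesgue_integral_eq_integral(2) unfolding set_lebesgue_integral_def by metis
  qed
  show ?thesis
    unfolding e
  proof (rule integral_dominated_convergence_at_top[where w = "\<lambda>x. norm (q x)"])
    show "(\<lambda>x. indicator {-R..R} x *\<^sub>R q x) \<in> borel_measurable lebesgue" for R
      by (rule borel_measurable_integrable[OF integrable_mult_indicator[OF _ q]]) simp
    show "\<forall>\<^sub>F R in at_top. AE x in lebesgue. norm (indicator {-R..R} x *\<^sub>R q x) \<le> norm (q x)"
      by (intro always_eventually allI AE_I2) (auto simp: indicator_def)
    show "AE x in lebesgue. ((\<lambda>R. indicator {-R..R} x *\<^sub>R q x) \<longlongrightarrow> q x) at_top"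
    proof (rule AE_I2)
      fix x :: real
      have "\<forall>\<^sub>F R in at_top. indicator {-R..R} x *\<^sub>R q x = q x"
        using eventually_ge_at_top[of "\<bar>x\<bar>"] by eventually_elim (auto simp: indicator_def abs_le_iff)
      then show "((\<lambda>R. indicator {-R..R} x *\<^sub>R q x) \<longlongrightarrow> q x) at_top"
        by (rule tendsto_eventually)
    qed
  qed (use q in auto)
qed

lemma continuous_on_horizontal:
  assumes "continuous_on {z. 0 < Im z} \<Psi>" "0 < y"
  shows "continuous_on UNIV (\<lambda>x. \<Psi> (Complex x y))"
  by (rule continuous_on_compose2[OF assms(1), of UNIV "\<lambda>x. Complex x y"])
    (use assms(2) in \<open>auto intro!: continuous_intros\<close>)

text \<open>Cauchy's formula for \<^term>\<open>\<Psi> z * \<zeta> / (\<zeta>\<^sup>2 + l\<^sup>2)\<close> with \<^term>\<open>\<zeta> = z - \<i> * y\<close>, whose only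
  pole in the half-plane \<^term>\<open>Im z \<ge> y\<close> is \<^term>\<open>\<i> * (y + l)\<close>.\<close>

lemma hardy1_conjugate_poisson:
  fixes \<Psi> :: "complex \<Rightarrow> complex"
  assumes hol: "\<Psi> holomorphic_on {z. 0 < Im z}"
    and int: "\<And>y. 0 < y \<Longrightarrow> integrable lebesgue (\<lambda>x. \<Psi> (Complex x y))"
    and bd: "\<And>y. 0 < y \<Longrightarrow> (\<integral>x. cmod (\<Psi> (Complex x y)) \<partial>lebesgue) \<le> K"
    and y: "0 < y" and l: "0 < l"
  shows "(\<integral>x. \<Psi> (Complex x y) * complex_of_real (x / (x\<^sup>2 + l\<^sup>2)) \<partial>lebesgue)
    = complex_of_real pi * \<i> * \<Psi> (Complex 0 (y + l))"
proof -
  define w where "w = Complex 0 (y + l)"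
  \<comment> \<open>The half-plane lies inside the domain of \<open>\<Psi>\<close> and above the
    other zero \<open>\<zeta> = - \<i> * l\<close> of the denominator. Hence \<open>p\<close> is
    holomorphic on it, and \<open>w\<close> is the only pole of \<open>q\<close>.\<close>
  define S where "S = {z. max 0 (y - l) < Im z}"
  define p where "p z = \<Psi> z * ((z - Complex 0 y) / (z - Complex 0 (y - l)))" for z
  define q where "q z = p z / (z - w)" for z
  have cont: "continuous_on {z. 0 < Im z} \<Psi>"
    by (rule holomorphic_on_imp_continuous_on[OF hol])
  have K: "0 \<le> K" using bd[OF y] by (rule order_trans[rotated]) simp
  have S: "open S" "convex S"
    unfolding S_def by (rule open_halfspace_Im_gt convex_halfspace_Im_gt)+
  have pole: "z - Complex 0 (y - l) \<noteq> 0" if "z \<in> S" for z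
    using that by (auto simp: S_def complex_eq_iff)
  have holp: "p holomorphic_on S"
    unfolding p_def
    by (intro holomorphic_intros holomorphic_on_subset[OF hol]) (use pole in \<open>auto simp: S_def\<close>)
  \<comment> \<open>The residue of \<open>\<zeta> / (\<zeta>\<^sup>2 + l\<^sup>2)\<close> at
    \<open>\<i> * l\<close> is one half, so the \<open>2 * pi * \<i>\<close> of Cauchy's formula
    becomes \<open>pi * \<i>\<close>.\<close>
  have pw: "p w = \<Psi> w / 2"
  proof -
    have "w - Complex 0 y = \<i> * complex_of_real l" "w - Complex 0 (y - l) = 2 * (\<i> * complex_of_real l)"
      by (simp_all add: w_def complex_eq_iff)
    then show ?thesis using l by (simp add: p_def)
  qed
  \<comment> \<open>On and above the line at height \<open>y\<close>, a point is at least as close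
    to \<open>\<i> * y\<close> as to \<open>\<i> * (y - l)\<close>. The quotient in \<open>p\<close>
    then has modulus at most 1, and only the distance to the pole \<open>w\<close> remains.\<close>
  have qle: "cmod (q z) \<le> cmod (\<Psi> z) / cmod (z - w)" if "y \<le> Im z" for z
  proof -
    have "(cmod (z - Complex 0 y))\<^sup>2 \<le> (cmod (z - Complex 0 (y - l)))\<^sup>2"
      unfolding cmod_power2 using that l by (simp add: power_mono)
    then have "cmod (z - Complex 0 y) \<le> cmod (z - Complex 0 (y - l))"
      by (rule power2_le_imp_le) simp
    then have "cmod ((z - Complex 0 y) / (z - Complex 0 (y - l))) \<le> 1"
      by (simp add: norm_divide divide_le_eq_1)
    then have "cmod (p z) \<le> cmod (\<Psi> z)"
      unfolding p_def norm_mult by (rule mult_left_le) simp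
    then show ?thesis unfolding q_def norm_divide by (rule divide_right_mono) simp
  qed
  have qcont: "continuous_on (S - {w}) q"
    unfolding q_def
    by (intro continuous_intros continuous_on_subset[OF holomorphic_on_imp_continuous_on[OF holp]]) auto
  have eq0: "q (Complex x y) = \<Psi> (Complex x y) * complex_of_real (x / (x\<^sup>2 + l\<^sup>2))" for x
  proof -
    have "Complex x y - Complex 0 y = complex_of_real x" "Complex x y - Complex 0 (y - l) = Complex x l"
      "Complex x y - w = Complex x (- l)"
      by (simp_all add: w_def complex_eq_iff)
    moreover have "Complex x l * Complex x (- l) = complex_of_real (x\<^sup>2 + l\<^sup>2)"
      by (simp add: complex_eq_iff power2_eq_square)
    ultimately show ?thesis unfolding q_def p_def by simp
  qed
  have qint: "integrable lebesgue (\<lambda>x. q (Complex x y))"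
  proof (rule Bochner_Integration.integrable_bound)
    show "integrable lebesgue (\<lambda>x. \<Psi> (Complex x y) * complex_of_real (1 / l))"
      by (intro integrable_mult_left int y)
    have "continuous_on UNIV (\<lambda>x. q (Complex x y))"
      unfolding eq0 using l
      by (intro continuous_intros continuous_on_horizontal[OF cont y]) (auto simp: add_nonneg_eq_0_iff)
    then show "(\<lambda>x. q (Complex x y)) \<in> borel_measurable lebesgue"
      by (simp add: borel_measurable_continuous_onI measurable_completion)
    show "AE x in lebesgue. norm (q (Complex x y)) \<le> norm (\<Psi> (Complex x y) * complex_of_real (1 / l))"
    proof (rule AE_I2)
      fix x
      have "l \<le> cmod (Complex x y - w)"
        using abs_Im_le_cmod[of "Complex x y - w"] l by (simp add: w_def)
      then have "cmod (\<Psi> (Complex x y)) / cmod (Complex x y - w) \<le> cmod (\<Psi> (Complex x y)) / l"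
        using l by (intro divide_left_mono mult_pos_pos) auto
      then show "norm (q (Complex x y)) \<le> norm (\<Psi> (Complex x y) * complex_of_real (1 / l))"
        using qle[of "Complex x y"] l by (simp add: norm_mult norm_divide)
    qed
  qed
  let ?B = "\<integral>x. q (Complex x y) \<partial>lebesgue"
  \<comment> \<open>One \<open>e\<close> is spent on truncating the bottom side, one on the top
    side, and one on the two vertical sides together.\<close>
  have "cmod (?B - complex_of_real pi * \<i> * \<Psi> w) \<le> 3 * e" if e: "0 < e" for e
  proof -
    have "\<forall>\<^sub>F R in at_top. dist (integral {-R..R} (\<lambda>x. q (Complex x y))) ?B < e"
      by (rule tendstoD[OF integrable_lebesgue_truncation_LIMSEQ[OF qint] e])
    then obtain N where N: "\<And>R. N \<le> R \<Longrightarrow> dist (integral {-R..R} (\<lambda>x. q (Complex x y))) ?B < e"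
      unfolding eventually_at_top_linorder by blast
    \<comment> \<open>The top side contributes at most \<open>K / (Y - (y + l))\<close>, which this
      height makes at most \<open>e\<close>. The summand 1 keeps the side strictly above the pole
      even if \<open>K = 0\<close>.\<close>
    define Y where "Y = y + l + K / e + 1"
    have "0 \<le> K / e" using K e by simp
    then have Y: "y + l < Y" "K / e \<le> Y - (y + l)" by (simp_all add: Y_def)
    have yY: "y < Y" using Y(1) l by simp
    define h where "h x s = (if s \<in> {y..Y} then cmod (\<Psi> (Complex x s)) else 0)" for x s
    \<comment> \<open>The bound \<open>N\<close> serves the truncation of the bottom side. The bound
      1 keeps the vertical sides at distance at least 1 from \<open>w\<close>, which lies on the
      imaginary axis, so that there \<open>cmod (q z)\<close> is at most
      \<open>cmod (\<Psi> z)\<close>.\<close>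
    have "\<exists>R\<ge>max N 1. integral {y..Y} (h R) + integral {y..Y} (h (- R)) \<le> e"
    proof (rule small_vertical_integrals[where K = K])
      have "continuous_on (UNIV \<times> {y..Y}) (\<lambda>p. cmod (\<Psi> (Complex (fst p) (snd p))))"
        by (intro continuous_on_norm continuous_on_compose2[OF cont, of _ "\<lambda>p. Complex (fst p) (snd p)"])
          (use y in \<open>auto intro!: continuous_intros\<close>)
      then show "continuous_on (UNIV \<times> {y..Y}) (\<lambda>p. h (fst p) (snd p))"
        by (rule continuous_on_eq) (auto simp: h_def)
      fix s assume s: "s \<in> {y..Y}"
      then have s0: "0 < s" using y by auto
      have "(\<lambda>x. cmod (\<Psi> (Complex x s))) \<in> borel_measurable borel"
        by (intro borel_measurable_continuous_onI continuous_on_norm continuous_on_horizontal[OF cont s0])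
      then have "(\<integral>\<^sup>+x. ennreal (h x s) \<partial>lborel) = (\<integral>\<^sup>+x. ennreal (cmod (\<Psi> (Complex x s))) \<partial>lebesgue)"
        using s by (simp add: h_def nn_integral_completion)
      also have "\<dots> = ennreal (\<integral>x. cmod (\<Psi> (Complex x s)) \<partial>lebesgue)"
        by (intro nn_integral_eq_integral integrable_norm int s0) auto
      also have "\<dots> \<le> ennreal K" by (intro ennreal_leI bd s0)
      finally show "(\<integral>\<^sup>+x. ennreal (h x s) \<partial>lborel) \<le> ennreal K" .
    qed (auto simp: h_def e)
    then obtain R where R: "N \<le> R" "1 \<le> R" and V: "integral {y..Y} (h R) + integral {y..Y} (h (- R)) \<le> e"
      by auto
    have wbox: "w \<in> box (Complex (-R) y) (Complex R Y)"
      using R l Y(1) by (simp add: in_box_complex_iff w_def)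
    have img: "path_image (rectpath (Complex (-R) y) (Complex R Y)) \<subseteq> S - {w}"
      using path_image_rectpath_subset_cbox[of "Complex (-R) y" "Complex R Y"]
        path_image_rectpath_inter_box[of "Complex (-R) y" "Complex R Y"] wbox R yY y l
      by (auto simp: S_def in_cbox_complex_iff)
    have "(q has_contour_integral (2 * pi * \<i> * winding_number (rectpath (Complex (-R) y) (Complex R Y)) w * p w))
        (rectpath (Complex (-R) y) (Complex R Y))"
      unfolding q_def
    proof (rule Cauchy_integral_formula_convex_simple[OF S(2) holp])
      show "w \<in> interior S"
        using y l by (simp add: interior_open[OF S(1)]) (simp add: S_def w_def)
    qed (use img in auto)
    then have "contour_integral (rectpath (Complex (-R) y) (Complex R Y)) q = complex_of_real pi * \<i> * \<Psi> w"
      by (simp add: contour_integral_unique winding_number_rectpath[OF wbox] pw)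
    then have main: "integral {-R..R} (\<lambda>x. q (Complex x y)) - complex_of_real pi * \<i> * \<Psi> w
        = integral {-R..R} (\<lambda>x. q (Complex x Y))
          - \<i> * (integral {y..Y} (\<lambda>s. q (Complex R s)) - integral {y..Y} (\<lambda>s. q (Complex (-R) s)))"
      using contour_integral_rectpath[OF continuous_on_subset[OF qcont img] _ yY] R
      by (simp add: algebra_simps)
    have top: "cmod (integral {-R..R} (\<lambda>x. q (Complex x Y))) \<le> e"
    proof -
      have Y0: "0 < Y" using yY y by simp
      let ?t = "\<lambda>x. cmod (\<Psi> (Complex x Y)) / (Y - (y + l))"
      have tc: "continuous_on UNIV ?t"
        using Y by (intro continuous_intros continuous_on_norm continuous_on_horizontal[OF cont Y0]) auto
      have t: "integrable lebesgue ?t"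
        by (intro integrable_divide_zero integrable_norm int Y0)
      have si: "set_integrable lebesgue {-R..R} ?t"
        unfolding set_integrable_def by (rule integrable_mult_indicator[OF _ t]) simp
      have "cmod (integral {-R..R} (\<lambda>x. q (Complex x Y))) \<le> integral {-R..R} ?t"
      proof (rule integral_norm_bound_integral)
        have "continuous_on {-R..R} (\<lambda>x. q (Complex x Y))"
          by (rule continuous_on_compose2[OF qcont, of _ "\<lambda>x. Complex x Y"])
            (use Y0 Y yY l in \<open>auto intro!: continuous_intros simp: S_def w_def\<close>)
        then show "(\<lambda>x. q (Complex x Y)) integrable_on {-R..R}" by (rule integrable_continuous_real)
        show "?t integrable_on {-R..R}"
          by (intro integrable_continuous_real continuous_on_subset[OF tc]) simp
        fix x
        have "Y - (y + l) \<le> cmod (Complex x Y - w)"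
          using abs_Im_le_cmod[of "Complex x Y - w"] Y by (simp add: w_def)
        then have "cmod (\<Psi> (Complex x Y)) / cmod (Complex x Y - w) \<le> ?t x"
          using Y by (intro divide_left_mono mult_pos_pos) auto
        then show "norm (q (Complex x Y)) \<le> ?t x"
          using qle[of "Complex x Y"] yY by simp
      qed
      also have "\<dots> = (LINT x:{-R..R}|lebesgue. ?t x)"
        by (rule set_lebesgue_integral_eq_integral(2)[OF si, symmetric])
      also have "\<dots> \<le> (\<integral>x. ?t x \<partial>lebesgue)"
        unfolding set_lebesgue_integral_def
        using Y by (intro integral_mono si[unfolded set_integrable_def] t) (auto simp: indicator_def)
      also have "\<dots> = (\<integral>x. cmod (\<Psi> (Complex x Y)) \<partial>lebesgue) / (Y - (y + l))"
        by simp
      also have "\<dots> \<le> K / (Y - (y + l))"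
        using Y by (intro divide_right_mono bd Y0) auto
      also have "\<dots> \<le> e"
        using Y e by (simp add: field_simps)
      finally show ?thesis .
    qed
    have side: "cmod (integral {y..Y} (\<lambda>s. q (Complex r s))) \<le> integral {y..Y} (h r)" if r: "1 \<le> \<bar>r\<bar>" for r
    proof (rule integral_norm_bound_integral)
      have "Complex r s \<noteq> w" for s
        using r by (auto simp: w_def)
      then have "continuous_on {y..Y} (\<lambda>s. q (Complex r s))"
        by (intro continuous_on_compose2[OF qcont, of _ "\<lambda>s. Complex r s"])
          (use y l in \<open>auto intro!: continuous_intros simp: S_def\<close>)
      then show "(\<lambda>s. q (Complex r s)) integrable_on {y..Y}" by (rule integrable_continuous_real)
      have "continuous_on {y..Y} (\<lambda>s. cmod (\<Psi> (Complex r s)))"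
        by (intro continuous_on_norm continuous_on_compose2[OF cont, of _ "\<lambda>s. Complex r s"])
          (use y in \<open>auto intro!: continuous_intros\<close>)
      then have "continuous_on {y..Y} (h r)"
        by (rule continuous_on_eq) (auto simp: h_def)
      then show "h r integrable_on {y..Y}" by (rule integrable_continuous_real)
      fix s assume s: "s \<in> {y..Y}"
      have "1 \<le> cmod (Complex r s - w)"
        using abs_Re_le_cmod[of "Complex r s - w"] r by (simp add: w_def)
      then have "cmod (\<Psi> (Complex r s)) / cmod (Complex r s - w) \<le> cmod (\<Psi> (Complex r s)) / 1"
        by (intro divide_left_mono) auto
      then show "norm (q (Complex r s)) \<le> h r s"
        using qle[of "Complex r s"] s by (simp add: h_def)
    qed
    have "cmod (integral {-R..R} (\<lambda>x. q (Complex x y)) - complex_of_real pi * \<i> * \<Psi> w) \<le> e + e"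
    proof -
      let ?a = "integral {-R..R} (\<lambda>x. q (Complex x Y))"
      let ?b = "integral {y..Y} (\<lambda>s. q (Complex R s))" and ?c = "integral {y..Y} (\<lambda>s. q (Complex (-R) s))"
      have "cmod (?a - \<i> * (?b - ?c)) \<le> cmod ?a + (cmod ?b + cmod ?c)"
        using norm_triangle_ineq4[of ?a "\<i> * (?b - ?c)"] norm_triangle_ineq4[of ?b ?c] by (simp add: norm_mult)
      then show ?thesis
        unfolding main using top side[of R] side[of "-R"] R V by simp
    qed
    then show ?thesis
      using N[OF R(1)] norm_triangle_ineq4[of "integral {-R..R} (\<lambda>x. q (Complex x y)) - complex_of_real pi * \<i> * \<Psi> w"
          "integral {-R..R} (\<lambda>x. q (Complex x y)) - ?B"]
      by (simp add: dist_norm)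
  qed
  from this[of "e / 3" for e] have "cmod (?B - complex_of_real pi * \<i> * \<Psi> w) \<le> 0 + e" if "0 < e" for e
    using that by simp
  then have "?B = complex_of_real pi * \<i> * \<Psi> w"
    using field_le_epsilon[of "cmod (?B - complex_of_real pi * \<i> * \<Psi> w)" 0] by simp
  then show ?thesis
    unfolding eq0 w_def .
qed

section \<open>Point masses\<close>

lemma L2fun_square_integrable: "L2fun f \<Longrightarrow> integrable lebesgue (\<lambda>x. (norm (f x))\<^sup>2)"
  by (simp add: L2fun_def)

text \<open>Takes the place of Cauchy-Schwarz for integrals: it is applied pointwise, and
  \<open>e\<close> can still be chosen after integration.\<close>

lemma weighted_am_gm:
  fixes u w e :: real
  assumes "0 < e"
  shows "2 * (u * w) \<le> u\<^sup>2 / e + e * w\<^sup>2"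
proof -
  have "0 \<le> (u - e * w)\<^sup>2 / e" using assms by simp
  also have "\<dots> = u\<^sup>2 / e + e * w\<^sup>2 - 2 * (u * w)"
    using assms by (simp add: power2_diff field_simps power2_eq_square)
  finally show ?thesis by simp
qed

lemma integrable_cinner:
  fixes u w :: "real \<Rightarrow> 'a::chilbert"
  assumes T: "bounded_linear T" and u: "L2fun u" and w: "L2fun w"
  shows "integrable lebesgue (\<lambda>x. cinner (u x) (T (w x)))"
proof -
  obtain K where K: "0 < K" "\<And>v. norm (T v) \<le> norm v * K"
    using bounded_linear.pos_bounded[OF T] by blast
  have i: "integrable lebesgue (\<lambda>x. K * ((norm (u x))\<^sup>2 + (norm (w x))\<^sup>2))"
    by (intro integrable_mult_right Bochner_Integration.integrable_add L2fun_square_integrable u w)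
  show ?thesis
  proof (rule Bochner_Integration.integrable_bound[OF i])
    show "(\<lambda>x. cinner (u x) (T (w x))) \<in> borel_measurable lebesgue"
      by (rule L2fun_compose2_measurable[OF u w, where B = "\<lambda>p q. cinner p (T q)"])
        (intro cinner.tendsto bounded_linear.tendsto[OF T])
    show "AE x in lebesgue. norm (cinner (u x) (T (w x))) \<le> norm (K * ((norm (u x))\<^sup>2 + (norm (w x))\<^sup>2))"
    proof (rule AE_I2)
      fix x
      have "norm (cinner (u x) (T (w x))) \<le> 2 * (norm (u x) * norm (T (w x)))"
        by (rule norm_cinner_le)
      also have "\<dots> \<le> 2 * (norm (u x) * (norm (w x) * K))"
        by (intro mult_left_mono K(2)) auto
      also have "\<dots> \<le> K * ((norm (u x))\<^sup>2 + (norm (w x))\<^sup>2)"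
        using mult_left_mono[OF weighted_am_gm[of 1 "norm (u x)" "norm (w x)"], of K] K(1)
        by (simp add: algebra_simps)
      finally show "norm (cinner (u x) (T (w x))) \<le> norm (K * ((norm (u x))\<^sup>2 + (norm (w x))\<^sup>2))"
        by simp
    qed
  qed
qed

lemma integrable_norm_diff_square:
  assumes u: "L2fun u" and w: "L2fun w"
  shows "integrable lebesgue (\<lambda>x. (norm (u x - w x))\<^sup>2)"
proof (rule Bochner_Integration.integrable_bound)
  show "integrable lebesgue (\<lambda>x. 2 * ((norm (u x))\<^sup>2 + (norm (w x))\<^sup>2))"
    by (intro integrable_mult_right Bochner_Integration.integrable_add L2fun_square_integrable u w)
  show "(\<lambda>x. (norm (u x - w x))\<^sup>2) \<in> borel_measurable lebesgue"
    by (rule L2fun_compose2_measurable[OF u w, where B = "\<lambda>p q. (norm (p - q))\<^sup>2"])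
      (intro tendsto_intros)
  show "AE x in lebesgue. norm ((norm (u x - w x))\<^sup>2) \<le> norm (2 * ((norm (u x))\<^sup>2 + (norm (w x))\<^sup>2))"
  proof (rule AE_I2)
    fix x
    have "(norm (u x - w x))\<^sup>2 \<le> (norm (u x) + norm (w x))\<^sup>2"
      by (intro power_mono norm_triangle_ineq4) simp
    also have "\<dots> \<le> 2 * ((norm (u x))\<^sup>2 + (norm (w x))\<^sup>2)"
      using weighted_am_gm[of 1 "norm (u x)" "norm (w x)"] by (simp add: power2_sum)
    finally show "norm ((norm (u x - w x))\<^sup>2) \<le> norm (2 * ((norm (u x))\<^sup>2 + (norm (w x))\<^sup>2))"
      by simp
  qed
qed

text \<open>Inserting \<open>cinner (c x) (T (b x))\<close> splits the difference into two products,
  each containing one of the errors \<open>a - c\<close> and \<open>b - d\<close>. The weight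
  \<open>e\<close> is left to the user: it balances small squared errors against merely bounded
  norms.\<close>

lemma integral_cinner_diff_le:
  fixes a b c d :: "real \<Rightarrow> 'a::chilbert"
  assumes T: "bounded_linear T" and K: "0 \<le> K" "\<And>v. norm (T v) \<le> norm v * K"
    and L2: "L2fun a" "L2fun b" "L2fun c" "L2fun d" and e: "0 < e"
  shows "(\<integral>x. cmod (cinner (a x) (T (b x)) - cinner (c x) (T (d x))) \<partial>lebesgue)
    \<le> K * (((\<integral>x. (norm (a x - c x))\<^sup>2 \<partial>lebesgue) + (\<integral>x. (norm (b x - d x))\<^sup>2 \<partial>lebesgue)) / e
      + e * ((\<integral>x. (norm (b x))\<^sup>2 \<partial>lebesgue) + (\<integral>x. (norm (c x))\<^sup>2 \<partial>lebesgue)))"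
proof -
  let ?r = "\<lambda>x. K * (((norm (a x - c x))\<^sup>2 + (norm (b x - d x))\<^sup>2) / e + e * ((norm (b x))\<^sup>2 + (norm (c x))\<^sup>2))"
  note i = integrable_norm_diff_square[OF L2(1,3)] integrable_norm_diff_square[OF L2(2,4)]
    L2fun_square_integrable[OF L2(2)] L2fun_square_integrable[OF L2(3)]
  have r: "integrable lebesgue ?r"
    using i by (intro integrable_mult_right Bochner_Integration.integrable_add integrable_divide_zero) auto
  have "(\<integral>x. cmod (cinner (a x) (T (b x)) - cinner (c x) (T (d x))) \<partial>lebesgue) \<le> (\<integral>x. ?r x \<partial>lebesgue)"
  proof (rule integral_mono[OF _ r])
    show "integrable lebesgue (\<lambda>x. cmod (cinner (a x) (T (b x)) - cinner (c x) (T (d x))))"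
      by (intro integrable_norm Bochner_Integration.integrable_diff integrable_cinner T L2)
    fix x
    have "cinner (a x) (T (b x)) - cinner (c x) (T (d x))
        = cinner (a x - c x) (T (b x)) + cinner (c x) (T (b x - d x))"
      by (simp add: cinner.diff_left cinner.diff_right linear_diff[OF bounded_linear.linear[OF T]])
    then have "cmod (cinner (a x) (T (b x)) - cinner (c x) (T (d x)))
        \<le> 2 * (norm (a x - c x) * norm (T (b x))) + 2 * (norm (c x) * norm (T (b x - d x)))"
      by (metis add_mono norm_cinner_le norm_triangle_le)
    also have "\<dots> \<le> 2 * (norm (a x - c x) * (norm (b x) * K)) + 2 * (norm (c x) * (norm (b x - d x) * K))"
      by (intro add_mono mult_left_mono K(2)) auto
    also have "\<dots> = K * (2 * (norm (a x - c x) * norm (b x)) + 2 * (norm (b x - d x) * norm (c x)))"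
      by (simp add: algebra_simps)
    also have "\<dots> \<le> K * (((norm (a x - c x))\<^sup>2 / e + e * (norm (b x))\<^sup>2) + ((norm (b x - d x))\<^sup>2 / e + e * (norm (c x))\<^sup>2))"
      by (intro mult_left_mono add_mono weighted_am_gm e K)
    also have "\<dots> = ?r x" by (simp add: algebra_simps add_divide_distrib)
    finally show "cmod (cinner (a x) (T (b x)) - cinner (c x) (T (d x))) \<le> ?r x" .
  qed
  also have "(\<integral>x. ?r x \<partial>lebesgue) = K * (((\<integral>x. (norm (a x - c x))\<^sup>2 \<partial>lebesgue) + (\<integral>x. (norm (b x - d x))\<^sup>2 \<partial>lebesgue)) / e
      + e * ((\<integral>x. (norm (b x))\<^sup>2 \<partial>lebesgue) + (\<integral>x. (norm (c x))\<^sup>2 \<partial>lebesgue)))"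
    using i by (simp add: Bochner_Integration.integral_add integrable_divide_zero)
  finally show ?thesis .
qed

text \<open>Two antilinear maps cancel: the first slot of \<open>cinner\<close> and the reflection
  \<open>z \<mapsto> - cnj z\<close>, which maps the upper half-plane to itself. The operator causes
  no harm because it commutes with \<open>cscale\<close>.\<close>

lemma hardy2_pairing_holomorphic:
  assumes F: "hardy2 F f" and G: "hardy2 G g" and T: "pos_op T"
  shows "(\<lambda>z. cinner (F (- cnj z)) (T (G z))) holomorphic_on {z. 0 < Im z}"
proof -
  have "\<exists>D. ((\<lambda>z. cinner (F (- cnj z)) (T (G z))) has_field_derivative D) (at z)" if z: "0 < Im z" for z
  proof -
    have "0 < Im (- cnj z)" using z by simp
    then obtain D where D: "(F has_derivative (\<lambda>h. cscale h D)) (at (- cnj z))"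
      using F unfolding hardy2_def by blast
    obtain E where E: "(G has_derivative (\<lambda>h. cscale h E)) (at z)"
      using G z unfolding hardy2_def by blast
    have "bounded_linear (\<lambda>z. - cnj z)"
      by (intro bounded_linear_minus bounded_linear_cnj)
    then have "((\<lambda>z. - cnj z) has_derivative (\<lambda>h. - cnj h)) (at z)"
      by (rule bounded_linear_imp_has_derivative)
    then have 1: "((\<lambda>z. F (- cnj z)) has_derivative (\<lambda>h. cscale (- cnj h) D)) (at z)"
      using D by (rule has_derivative_compose)
    have 2: "((\<lambda>z. T (G z)) has_derivative (\<lambda>h. T (cscale h E))) (at z)"
      by (rule bounded_linear.has_derivative[OF pos_op_linear[OF T] E])
    have "((\<lambda>z. cinner (F (- cnj z)) (T (G z))) has_derivative
        (\<lambda>h. cinner (F (- cnj z)) (T (cscale h E)) + cinner (cscale (- cnj h) D) (T (G z)))) (at z)"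
      by (rule cinner.FDERIV[OF 1 2])
    moreover have "cinner (F (- cnj z)) (T (cscale h E)) + cinner (cscale (- cnj h) D) (T (G z))
        = (cinner (F (- cnj z)) (T E) - cinner D (T (G z))) * h" for h
      by (simp add: pos_op_cscale[OF T] cinner_cscale_left cinner_cscale_right algebra_simps)
    ultimately show ?thesis unfolding has_field_derivative_def by auto
  qed
  then show ?thesis
    by (auto simp: holomorphic_on_open open_halfspace_Im_gt)
qed

lemma abs_conjugate_poisson_le:
  assumes "0 < (l::real)"
  shows "\<bar>x / (x\<^sup>2 + l\<^sup>2)\<bar> \<le> 1 / l"
proof -
  have "2 * (\<bar>x\<bar> * l) \<le> x\<^sup>2 + l\<^sup>2"
    using weighted_am_gm[of 1 "\<bar>x\<bar>" l] by simp
  moreover have "0 \<le> \<bar>x\<bar> * l" using assms by simp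
  ultimately have "\<bar>x\<bar> * l \<le> x\<^sup>2 + l\<^sup>2" by linarith
  moreover have "0 < x\<^sup>2 + l\<^sup>2" using assms by (simp add: add_nonneg_pos)
  ultimately show ?thesis using assms by (simp add: field_simps)
qed

text \<open>Cauchy's formula is available at each height \<open>y > 0\<close> and is carried to the
  boundary. On the side of the integrals the pairings converge in L^1 and the kernel is bounded by
  \<open>1 / l\<close>; on the other side \<open>\<Psi>\<close> is continuous at
  \<open>\<i> * l\<close>. The value pairs \<open>F\<close> and \<open>G\<close> at the same point
  because \<open>z \<mapsto> - cnj z\<close> fixes the imaginary axis.\<close>

lemma
  assumes F: "hardy2 F f" and G: "hardy2 G g" and T: "pos_op T" and l: "0 < l"
  shows integrable_point_mass_symbol:
      "integrable lebesgue (\<lambda>x. complex_of_real (x / (x\<^sup>2 + l\<^sup>2)) * cinner (f x) (T (g (- x))))"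
    and integral_point_mass_symbol:
      "(\<integral>x. complex_of_real (x / (x\<^sup>2 + l\<^sup>2)) * cinner (f x) (T (g (- x))) \<partial>lebesgue)
        = - (\<i> * complex_of_real pi) * cinner (F (\<i> * complex_of_real l)) (T (G (\<i> * complex_of_real l)))"
proof -
  define \<Psi> where "\<Psi> z = cinner (F (- cnj z)) (T (G z))" for z
  define \<psi> where "\<psi> x = cinner (f (- x)) (T (g x))" for x
  define k where "k x = complex_of_real (x / (x\<^sup>2 + l\<^sup>2))" for x
  have TL: "bounded_linear T" by (rule pos_op_linear[OF T])
  obtain K where K: "0 < K" "\<And>v. norm (T v) \<le> norm v * K"
    using bounded_linear.pos_bounded[OF TL] by blast
  have K0: "0 \<le> K" using K by simp
  have f: "L2fun f" and g: "L2fun g" using F G by (auto simp: hardy2_def)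
  note fr = L2fun_reflect[OF f]
  have Fy: "L2fun (\<lambda>x. F (Complex x y))" and Gy: "L2fun (\<lambda>x. G (Complex x y))" if "0 < y" for y
    using F G that unfolding hardy2_def by blast+
  note Fyr = L2fun_reflect[OF Fy]
  obtain CF where CF: "\<And>y. 0 < y \<Longrightarrow> (\<integral>x. (norm (F (Complex x y)))\<^sup>2 \<partial>lebesgue) \<le> CF"
    using F unfolding hardy2_def by blast
  obtain CG where CG: "\<And>y. 0 < y \<Longrightarrow> (\<integral>x. (norm (G (Complex x y)))\<^sup>2 \<partial>lebesgue) \<le> CG"
    using G unfolding hardy2_def by blast
  have \<Psi>xy: "\<Psi> (Complex x y) = cinner (F (Complex (- x) y)) (T (G (Complex x y)))" for x y
  proof -
    have "- cnj (Complex x y) = Complex (- x) y" by (simp add: complex_eq_iff)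
    then show ?thesis by (simp add: \<Psi>_def)
  qed
  have hol: "\<Psi> holomorphic_on {z. 0 < Im z}"
    unfolding \<Psi>_def by (rule hardy2_pairing_holomorphic[OF F G T])
  have \<Psi>int: "integrable lebesgue (\<lambda>x. \<Psi> (Complex x y))" if "0 < y" for y
    unfolding \<Psi>xy by (rule integrable_cinner[OF TL Fyr[OF that] Gy[OF that]])
  have \<psi>int: "integrable lebesgue \<psi>"
    unfolding \<psi>_def by (rule integrable_cinner[OF TL fr g])
  have refl: "(\<integral>x. (norm (F (Complex (- x) y) - f (- x)))\<^sup>2 \<partial>lebesgue) = (\<integral>x. (norm (F (Complex x y) - f x))\<^sup>2 \<partial>lebesgue)"
    "(\<integral>x. (norm (F (Complex (- x) y)))\<^sup>2 \<partial>lebesgue) = (\<integral>x. (norm (F (Complex x y)))\<^sup>2 \<partial>lebesgue)" if y: "0 < y" for y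
    using integral_lebesgue_reflect[OF borel_measurable_integrable[OF integrable_norm_diff_square[OF Fy[OF y] f]]]
      integral_lebesgue_reflect[OF borel_measurable_integrable[OF L2fun_square_integrable[OF Fy[OF y]]]]
    by auto
  have bd: "(\<integral>x. cmod (\<Psi> (Complex x y)) \<partial>lebesgue) \<le> K * (CF + CG)" if y: "0 < y" for y
  proof -
    have "(\<integral>x. cmod (\<Psi> (Complex x y)) \<partial>lebesgue)
        \<le> (\<integral>x. K * ((norm (F (Complex (- x) y)))\<^sup>2 + (norm (G (Complex x y)))\<^sup>2) \<partial>lebesgue)"
    proof (rule integral_mono)
      show "integrable lebesgue (\<lambda>x. K * ((norm (F (Complex (- x) y)))\<^sup>2 + (norm (G (Complex x y)))\<^sup>2))"
        by (intro integrable_mult_right Bochner_Integration.integrable_add L2fun_square_integrable Fyr Gy y)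
      fix x
      let ?u = "F (Complex (- x) y)" and ?w = "G (Complex x y)"
      have "cmod (\<Psi> (Complex x y)) \<le> 2 * (norm ?u * norm (T ?w))"
        unfolding \<Psi>xy by (rule norm_cinner_le)
      also have "\<dots> \<le> 2 * (norm ?u * (norm ?w * K))"
        by (intro mult_left_mono K(2)) auto
      also have "\<dots> \<le> K * ((norm ?u)\<^sup>2 + (norm ?w)\<^sup>2)"
        using mult_left_mono[OF weighted_am_gm[of 1 "norm ?u" "norm ?w"], of K] K(1)
        by (simp add: algebra_simps)
      finally show "cmod (\<Psi> (Complex x y)) \<le> K * ((norm ?u)\<^sup>2 + (norm ?w)\<^sup>2)" .
    qed (intro integrable_norm \<Psi>int y)
    also have "\<dots> = K * ((\<integral>x. (norm (F (Complex x y)))\<^sup>2 \<partial>lebesgue) + (\<integral>x. (norm (G (Complex x y)))\<^sup>2 \<partial>lebesgue))"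
      using L2fun_square_integrable[OF Fyr[OF y]] L2fun_square_integrable[OF Gy[OF y]] refl(2)[OF y] by simp
    also have "\<dots> \<le> K * (CF + CG)"
      by (intro mult_left_mono add_mono CF CG y K0)
    finally show ?thesis .
  qed
  have kle: "cmod (k x) \<le> 1 / l" for x
    unfolding k_def norm_of_real by (rule abs_conjugate_poisson_le[OF l])
  have km: "k \<in> borel_measurable lebesgue"
  proof -
    have "continuous_on UNIV k"
      unfolding k_def using l by (intro continuous_intros) (auto simp: add_nonneg_eq_0_iff)
    then show ?thesis by (simp add: borel_measurable_continuous_onI measurable_completion)
  qed
  have ki: "integrable lebesgue (\<lambda>x. u x * k x)" if u: "integrable lebesgue u" for u :: "real \<Rightarrow> complex"
  proof (rule Bochner_Integration.integrable_bound)
    show "integrable lebesgue (\<lambda>x. u x * complex_of_real (1 / l))" using u by (rule integrable_mult_left)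
    show "(\<lambda>x. u x * k x) \<in> borel_measurable lebesgue"
      using km borel_measurable_integrable[OF u] by (rule borel_measurable_times[rotated])
    show "AE x in lebesgue. norm (u x * k x) \<le> norm (u x * complex_of_real (1 / l))"
      unfolding norm_mult norm_of_real using kle l by (intro AE_I2 mult_left_mono) auto
  qed
  define D where "D y = (\<integral>x. (norm (F (Complex x y) - f x))\<^sup>2 \<partial>lebesgue) + (\<integral>x. (norm (G (Complex x y) - g x))\<^sup>2 \<partial>lebesgue)" for y
  define B where "B = CG + (\<integral>x. (norm (f (- x)))\<^sup>2 \<partial>lebesgue)"
  have D0: "0 \<le> D y" for y
    unfolding D_def by (intro add_nonneg_nonneg integral_nonneg_AE AE_I2) auto
  have Dlim: "(D \<longlongrightarrow> 0) (at_right 0)"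
    using F G unfolding D_def hardy2_def by (auto intro: tendsto_eq_intros)
  have close: "(\<integral>x. cmod (\<Psi> (Complex x y) - \<psi> x) \<partial>lebesgue) \<le> K * (sqrt (D y) + (sqrt (D y) + y) * B)" if y: "0 < y" for y
  proof -
    \<comment> \<open>This weight makes both \<open>D y / e\<close> and \<open>e\<close> tend to
      zero with \<open>y\<close>. The summand \<open>y\<close> keeps it positive when
      \<open>D y = 0\<close>.\<close>
    define e where "e = sqrt (D y) + y"
    have e: "0 < e" using y D0[of y] by (simp add: e_def add_nonneg_pos)
    have "(\<integral>x. cmod (\<Psi> (Complex x y) - \<psi> x) \<partial>lebesgue)
        \<le> K * (D y / e + e * ((\<integral>x. (norm (G (Complex x y)))\<^sup>2 \<partial>lebesgue) + (\<integral>x. (norm (f (- x)))\<^sup>2 \<partial>lebesgue)))"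
      using integral_cinner_diff_le[OF TL K0 K(2) Fyr[OF y] Gy[OF y] fr g e]
      unfolding \<Psi>xy \<psi>_def D_def refl(1)[OF y] .
    also have "\<dots> \<le> K * (sqrt (D y) + e * B)"
    proof (rule mult_left_mono[OF add_mono K0])
      have "D y = sqrt (D y) * sqrt (D y)" using D0[of y] by simp
      also have "\<dots> \<le> sqrt (D y) * e" using y D0[of y] by (intro mult_left_mono) (auto simp: e_def)
      finally show "D y / e \<le> sqrt (D y)" using e by (simp add: pos_divide_le_eq)
      show "e * ((\<integral>x. (norm (G (Complex x y)))\<^sup>2 \<partial>lebesgue) + (\<integral>x. (norm (f (- x)))\<^sup>2 \<partial>lebesgue)) \<le> e * B"
        unfolding B_def using CG[OF y] e by (intro mult_left_mono) auto
    qed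
    finally show ?thesis unfolding e_def .
  qed
  have lim1: "((\<lambda>y. \<integral>x. \<Psi> (Complex x y) * k x \<partial>lebesgue) \<longlongrightarrow> (\<integral>x. \<psi> x * k x \<partial>lebesgue)) (at_right 0)"
  proof (subst tendsto_dist_iff, rule Lim_null_comparison)
    have "((\<lambda>y. K * (sqrt (D y) + (sqrt (D y) + y) * B) * (1 / l)) \<longlongrightarrow> K * (sqrt 0 + (sqrt 0 + 0) * B) * (1 / l)) (at_right 0)"
      by (intro tendsto_intros Dlim)
    then show "((\<lambda>y. K * (sqrt (D y) + (sqrt (D y) + y) * B) * (1 / l)) \<longlongrightarrow> 0) (at_right 0)" by simp
    have "norm (dist (\<integral>x. \<Psi> (Complex x y) * k x \<partial>lebesgue) (\<integral>x. \<psi> x * k x \<partial>lebesgue))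
        \<le> K * (sqrt (D y) + (sqrt (D y) + y) * B) * (1 / l)" if y: "0 < y" for y
    proof -
      let ?d = "\<lambda>x. \<Psi> (Complex x y) - \<psi> x"
      have d: "integrable lebesgue ?d"
        by (intro Bochner_Integration.integrable_diff \<Psi>int y \<psi>int)
      have "(\<integral>x. \<Psi> (Complex x y) * k x \<partial>lebesgue) - (\<integral>x. \<psi> x * k x \<partial>lebesgue) = (\<integral>x. ?d x * k x \<partial>lebesgue)"
        unfolding left_diff_distrib
        by (rule Bochner_Integration.integral_diff[OF ki[OF \<Psi>int[OF y]] ki[OF \<psi>int], symmetric])
      then have "norm (dist (\<integral>x. \<Psi> (Complex x y) * k x \<partial>lebesgue) (\<integral>x. \<psi> x * k x \<partial>lebesgue)) = cmod (\<integral>x. ?d x * k x \<partial>lebesgue)"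
        by (simp add: dist_norm)
      also have "\<dots> \<le> (\<integral>x. cmod (?d x * k x) \<partial>lebesgue)"
        by (rule integral_norm_bound)
      also have "\<dots> \<le> (\<integral>x. cmod (?d x) * (1 / l) \<partial>lebesgue)"
      proof (rule integral_mono)
        show "integrable lebesgue (\<lambda>x. cmod (?d x * k x))" by (intro integrable_norm ki d)
        show "integrable lebesgue (\<lambda>x. cmod (?d x) * (1 / l))" by (intro integrable_mult_left integrable_norm d)
        show "cmod (?d x * k x) \<le> cmod (?d x) * (1 / l)" for x
          unfolding norm_mult by (intro mult_left_mono kle) simp
      qed
      also have "\<dots> = (\<integral>x. cmod (?d x) \<partial>lebesgue) * (1 / l)"
        by (rule integral_mult_left_zero)
      also have "\<dots> \<le> K * (sqrt (D y) + (sqrt (D y) + y) * B) * (1 / l)"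
        using l by (intro mult_right_mono close y) auto
      finally show ?thesis .
    qed
    then show "\<forall>\<^sub>F y in at_right 0. norm (dist (\<integral>x. \<Psi> (Complex x y) * k x \<partial>lebesgue) (\<integral>x. \<psi> x * k x \<partial>lebesgue))
        \<le> K * (sqrt (D y) + (sqrt (D y) + y) * B) * (1 / l)"
      by (rule eventually_mono[OF eventually_at_right_less])
  qed
  have lim2: "((\<lambda>y. \<integral>x. \<Psi> (Complex x y) * k x \<partial>lebesgue) \<longlongrightarrow> complex_of_real pi * \<i> * \<Psi> (Complex 0 l)) (at_right 0)"
  proof (rule Lim_transform_eventually)
    have "isCont \<Psi> (Complex 0 (0 + l))"
      using holomorphic_on_imp_continuous_on[OF hol] l
      by (simp add: continuous_on_eq_continuous_at open_halfspace_Im_gt)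
    moreover have "((\<lambda>y. Complex 0 (y + l)) \<longlongrightarrow> Complex 0 (0 + l)) (at_right 0)"
      by (intro tendsto_intros)
    ultimately have "((\<lambda>y. \<Psi> (Complex 0 (y + l))) \<longlongrightarrow> \<Psi> (Complex 0 (0 + l))) (at_right 0)"
      by (rule isCont_tendsto_compose)
    then show "((\<lambda>y. complex_of_real pi * \<i> * \<Psi> (Complex 0 (y + l))) \<longlongrightarrow> complex_of_real pi * \<i> * \<Psi> (Complex 0 l)) (at_right 0)"
      by (intro tendsto_intros) simp
    have "complex_of_real pi * \<i> * \<Psi> (Complex 0 (y + l)) = (\<integral>x. \<Psi> (Complex x y) * k x \<partial>lebesgue)" if "0 < y" for y
      unfolding k_def by (rule hardy1_conjugate_poisson[OF hol \<Psi>int bd that l, symmetric])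
    then show "\<forall>\<^sub>F y in at_right 0. complex_of_real pi * \<i> * \<Psi> (Complex 0 (y + l)) = (\<integral>x. \<Psi> (Complex x y) * k x \<partial>lebesgue)"
      by (rule eventually_mono[OF eventually_at_right_less])
  qed
  have main: "(\<integral>x. \<psi> x * k x \<partial>lebesgue) = complex_of_real pi * \<i> * \<Psi> (Complex 0 l)"
    by (rule tendsto_unique[OF _ lim1 lim2]) simp
  have i\<psi>: "integrable lebesgue (\<lambda>x. \<psi> x * k x)" by (rule ki[OF \<psi>int])
  \<comment> \<open>The substitution \<open>x \<mapsto> - x\<close> moves the reflection from
    \<open>f\<close> to \<open>g\<close>. The kernel is odd, which accounts for the minus sign in
    the formula.\<close>
  have sym: "\<psi> (- x) * k (- x) = - (complex_of_real (x / (x\<^sup>2 + l\<^sup>2)) * cinner (f x) (T (g (- x))))" for x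
    by (simp add: \<psi>_def k_def)
  show "integrable lebesgue (\<lambda>x. complex_of_real (x / (x\<^sup>2 + l\<^sup>2)) * cinner (f x) (T (g (- x))))"
    using integrable_lebesgue_reflect[OF i\<psi>] unfolding sym by simp
  have "- (\<integral>x. complex_of_real (x / (x\<^sup>2 + l\<^sup>2)) * cinner (f x) (T (g (- x))) \<partial>lebesgue) = (\<integral>x. \<psi> x * k x \<partial>lebesgue)"
    using integral_lebesgue_reflect[OF borel_measurable_integrable[OF i\<psi>]] unfolding sym by simp
  moreover have "- cnj (Complex 0 l) = \<i> * complex_of_real l" "Complex 0 l = \<i> * complex_of_real l"
    by (simp_all add: complex_eq_iff)
  ultimately show "(\<integral>x. complex_of_real (x / (x\<^sup>2 + l\<^sup>2)) * cinner (f x) (T (g (- x))) \<partial>lebesgue)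
        = - (\<i> * complex_of_real pi) * cinner (F (\<i> * complex_of_real l)) (T (G (\<i> * complex_of_real l)))"
    unfolding main \<Psi>_def by (simp add: minus_equation_iff mult.commute mult.left_commute)
qed

section \<open>Passage to the limit\<close>

definition polarize :: "('a::chilbert \<Rightarrow> real) \<Rightarrow> 'a \<Rightarrow> 'a \<Rightarrow> complex" where
  "polarize Q y w = (\<Sum>k<4::nat. \<i> ^ k * complex_of_real (Q (w + cscale (\<i> ^ k) y))) / 4"

lemma cinner_eq_polarize: "pos_op T \<Longrightarrow> cinner y (T w) = polarize (\<lambda>u. Re (cinner u (T u))) y w"
  unfolding polarize_def by (rule pos_op_polarization)

lemma tendsto_polarize:
  assumes "\<And>u. ((\<lambda>n. Q n u) \<longlongrightarrow> P u) A"
  shows "((\<lambda>n. polarize (Q n) y w) \<longlongrightarrow> polarize P y w) A"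
  unfolding polarize_def by (intro tendsto_intros assms) simp

text \<open>All four arguments of \<open>Q\<close> have norm at most \<open>norm w + norm y\<close>,
  and the division by 4 averages the resulting estimates.\<close>

lemma norm_polarize_le:
  assumes "\<And>u. \<bar>Q u\<bar> \<le> C * (norm u)\<^sup>2"
  shows "cmod (polarize Q y w) \<le> C * (norm w + norm y)\<^sup>2"
proof -
  \<comment> \<open>A single nonzero vector forces \<open>C\<close> to be nonnegative. If there is
    none, \<open>y\<close> and \<open>w\<close> vanish and so do the norms in the bound.\<close>
  have "0 \<le> C" if "u \<noteq> 0" for u :: 'a
    using order_trans[OF abs_ge_zero assms[of u]] that by (simp add: zero_le_mult_iff)
  then have C: "0 \<le> C \<or> (norm w + norm y)\<^sup>2 = 0" by (metis add_0 norm_eq_zero power_zero_numeral)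
  have "cmod (\<i> ^ k * complex_of_real (Q (w + cscale (\<i> ^ k) y))) \<le> C * (norm w + norm y)\<^sup>2" for k :: nat
  proof -
    have n: "norm (w + cscale (\<i> ^ k) y) \<le> norm w + norm y"
      using norm_triangle_ineq[of w "cscale (\<i> ^ k) y"] by (simp add: norm_cscale norm_power)
    have "\<bar>Q (w + cscale (\<i> ^ k) y)\<bar> \<le> C * (norm (w + cscale (\<i> ^ k) y))\<^sup>2" by (rule assms)
    also have "\<dots> \<le> C * (norm w + norm y)\<^sup>2"
    proof (cases "0 \<le> C")
      case True
      then show ?thesis by (intro mult_left_mono power_mono n) auto
    next
      case False
      then have z: "norm w + norm y = 0" using C by simp
      then have "w + cscale (\<i> ^ k) y = 0" using n by simp
      then show ?thesis using z by simp
    qed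
    finally show ?thesis by (simp add: norm_mult norm_power)
  qed
  then have "(\<Sum>k<4::nat. cmod (\<i> ^ k * complex_of_real (Q (w + cscale (\<i> ^ k) y)))) \<le> (\<Sum>k<4::nat. C * (norm w + norm y)\<^sup>2)"
    by (intro sum_mono) auto
  moreover have "cmod (\<Sum>k<4::nat. \<i> ^ k * complex_of_real (Q (w + cscale (\<i> ^ k) y)))
      \<le> (\<Sum>k<4::nat. cmod (\<i> ^ k * complex_of_real (Q (w + cscale (\<i> ^ k) y))))"
    by (rule norm_sum)
  ultimately show ?thesis
    unfolding polarize_def norm_divide by simp
qed

text \<open>For unit vectors the squared sum of norms is 4, and real homogeneity rescales to
  arbitrary vectors.\<close>

lemma bilinear_form_bound:
  fixes B :: "'a::real_normed_vector \<Rightarrow> 'a \<Rightarrow> complex"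
  assumes hom: "\<And>r s y w. B (r *\<^sub>R y) (s *\<^sub>R w) = complex_of_real (r * s) * B y w"
    and bd: "\<And>y w. cmod (B y w) \<le> C * (norm w + norm y)\<^sup>2"
  shows "cmod (B y w) \<le> 4 * C * norm y * norm w"
proof (cases "y = 0 \<or> w = 0")
  case True
  then have "B y w = 0" using hom[of 0 y 1 w] hom[of 1 y 0 w] by auto
  then show ?thesis using True by auto
next
  case False
  have "B y w = complex_of_real (norm y * norm w) * B (sgn y) (sgn w)"
    using hom[of "norm y" "sgn y" "norm w" "sgn w"] False by (simp add: sgn_div_norm)
  then have "cmod (B y w) = norm y * norm w * cmod (B (sgn y) (sgn w))"
    by (simp add: norm_mult)
  also have "\<dots> \<le> norm y * norm w * (C * (norm (sgn w) + norm (sgn y))\<^sup>2)"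
    by (intro mult_left_mono bd) auto
  finally show ?thesis using False by (simp add: norm_sgn mult_ac)
qed

text \<open>Links two readings, with \<open>\<phi> = cpoisson x\<close>. For fixed \<open>x\<close>
  it is a Riemann-Stieltjes sum for a matrix coefficient of \<open>pi\<close> times
  \<open>Imu\<close>. For a fixed partition it is a finite combination of kernels belonging to the
  point masses \<open>M (cell a b n j)\<close> at the right endpoints, the tags used in
  \<open>rs_sum\<close>.\<close>

definition stieltjes_sum ::
    "(real set \<Rightarrow> 'a::chilbert \<Rightarrow> 'a) \<Rightarrow> (real \<Rightarrow> real) \<Rightarrow> real \<Rightarrow> real \<Rightarrow> nat \<Rightarrow> 'a \<Rightarrow> 'a \<Rightarrow> complex" where
  "stieltjes_sum M \<phi> a b n y w =
    (\<Sum>j\<in>{1..n}. complex_of_real (\<phi> (grid a b n j)) * cinner y (M (cell a b n j) w))"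

lemma pos_op_cell:
  "opmeasure M \<Longrightarrow> 0 < a \<Longrightarrow> a < b \<Longrightarrow> j \<in> {1..n} \<Longrightarrow> pos_op (M (cell a b n j))"
  by (rule opmeasure_pos_op[of M _ b]) (use cell_subset[of a b j n] in auto)

lemma stieltjes_sum_polarize:
  assumes "opmeasure M" "0 < a" "a < b"
  shows "stieltjes_sum M \<phi> a b n y w
    = polarize (\<lambda>u. \<Sum>j\<in>{1..n}. qform M u (cell a b n j) * \<phi> (grid a b n j)) y w"
proof -
  have "stieltjes_sum M \<phi> a b n y w = (\<Sum>j\<in>{1..n}. complex_of_real (\<phi> (grid a b n j)) *
      polarize (\<lambda>u. qform M u (cell a b n j)) y w)"
    unfolding stieltjes_sum_def qform_def
    by (intro sum.cong refl arg_cong2[where f = "(*)"] cinner_eq_polarize pos_op_cell[OF assms])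
  also have "\<dots> = polarize (\<lambda>u. \<Sum>j\<in>{1..n}. qform M u (cell a b n j) * \<phi> (grid a b n j)) y w"
    unfolding polarize_def sum_divide_distrib[symmetric] times_divide_eq_right sum_distrib_left of_real_sum
    by (subst sum.swap) (simp add: mult_ac)
  finally show ?thesis .
qed

text \<open>Homogeneity is read off the operators themselves, since the polarized form does not
  display it. It is what \<open>bilinear_form_bound\<close> asks for.\<close>

lemma stieltjes_sum_scaleR:
  assumes "opmeasure M" "0 < a" "a < b"
  shows "stieltjes_sum M \<phi> a b n (r *\<^sub>R y) (s *\<^sub>R w) = complex_of_real (r * s) * stieltjes_sum M \<phi> a b n y w"
proof -
  have "cinner (r *\<^sub>R y) (M (cell a b n j) (s *\<^sub>R w)) = complex_of_real (r * s) * cinner y (M (cell a b n j) w)"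
    if "j \<in> {1..n}" for j
    using pos_op_linear[OF pos_op_cell[OF assms that]]
    by (simp add: linear_cmul[OF bounded_linear.linear] cinner.scaleR_left cinner.scaleR_right scaleR_conv_of_real)
  then show ?thesis
    unfolding stieltjes_sum_def sum_distrib_left by (intro sum.cong refl) (simp add: mult_ac)
qed

text \<open>Up to the factor \<open>1 / pi\<close>, the conjugate Poisson kernel of the upper
  half-plane at height \<open>t\<close>.\<close>

definition cpoisson :: "real \<Rightarrow> real \<Rightarrow> real" where
  "cpoisson x t = x / (x\<^sup>2 + t\<^sup>2)"

lemma continuous_on_cpoisson: "continuous_on {0<..} (cpoisson x)"
  unfolding cpoisson_def[abs_def] by (intro continuous_intros) (auto simp: add_nonneg_eq_0_iff)

lemma abs_cpoisson: "\<bar>cpoisson x t\<bar> = \<bar>x\<bar> / (t\<^sup>2 + x\<^sup>2)"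
  by (simp add: cpoisson_def abs_divide add.commute abs_of_nonneg)

lemma Im_nkernel: "Im (nkernel (complex_of_real x) t) = cpoisson x t"
  by (simp add: nkernel_def cpoisson_def Im_divide power2_eq_square add.commute)

lemma integrable_cpoisson:
  assumes "carleson M"
  shows "integrable (qmeas M v) (cpoisson x)"
proof -
  obtain C where "\<And>x v. integrable (qmeas M v) (\<lambda>t. \<bar>x\<bar> / (t\<^sup>2 + x\<^sup>2))"
    using carleson_poisson_bound[OF assms] by blast
  then show ?thesis
    by (rule Bochner_Integration.integrable_bound)
      (auto simp: abs_cpoisson measurable_qmeas_continuous[OF continuous_on_cpoisson])
qed

text \<open>Passing to the adjoint exchanges \<open>y\<close> and \<open>w\<close>. For
  \<open>d * c = 1\<close> with \<open>d\<close> unimodular, \<open>y + cscale c w\<close> and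
  \<open>w + cscale d y\<close> differ by a unimodular factor and carry the same measure, so the
  exchange merely swaps the terms for \<open>\<i>\<close> and \<open>- \<i>\<close>. After
  conjugation the weights agree with the original ones, and only the imaginary part of the kernel
  survives.\<close>

lemma Imu_eq_polarize:
  assumes M: "carleson M" and x: "x \<noteq> 0"
  shows "Imu M x y w = polarize (\<lambda>u. \<integral>t. cpoisson x t \<partial>qmeas M u) y w / complex_of_real pi"
proof -
  have M': "opmeasure M" using M by (simp add: carleson_def)
  let ?q = "\<lambda>c. \<integral>t. nkernel (complex_of_real x) t \<partial>qmeas M (w + cscale c y)"
  have swap: "qmeas M (y + cscale c w) = qmeas M (w + cscale d y)" if "d * c = 1" "cmod d = 1" for c d
  proof -
    have "w + cscale d y = cscale d (y + cscale c w)"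
      using that(1) by (simp add: cscale.add_right cscale_mult[symmetric])
    then show ?thesis using qmeas_cscale[OF M' that(2)] by simp
  qed
  have im: "?q c - cnj (?q c) = 2 * \<i> * complex_of_real (\<integral>t. cpoisson x t \<partial>qmeas M (w + cscale c y))" for c
  proof -
    have "Im (?q c) = (\<integral>t. cpoisson x t \<partial>qmeas M (w + cscale c y))"
      unfolding Im_nkernel[symmetric] by (rule integral_Im[symmetric, OF integrable_nkernel[OF M x]])
    then show ?thesis by (simp add: complex_eq_iff)
  qed
  have q: "qmeas M (y + cscale 1 w) = qmeas M (w + cscale 1 y)"
    "qmeas M (y + cscale \<i> w) = qmeas M (w + cscale (- \<i>) y)"
    "qmeas M (y + cscale (- 1) w) = qmeas M (w + cscale (- 1) y)"
    "qmeas M (y + cscale (- \<i>) w) = qmeas M (w + cscale \<i> y)"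
    by (rule swap; simp)+
  have p: "\<i> ^ 0 = 1" "\<i> ^ 1 = \<i>" "\<i> ^ 2 = - 1" "\<i> ^ 3 = - \<i>"
    by (simp_all add: eval_nat_numeral)
  have s1: "sint M (nkernel (complex_of_real x)) y w = (?q 1 + \<i> * ?q \<i> - ?q (- 1) - \<i> * ?q (- \<i>)) / 4"
    unfolding sint_def sum_lessThan_4 p by simp
  have s2: "cnj (sint M (nkernel (complex_of_real x)) w y)
      = (cnj (?q 1) - \<i> * cnj (?q (- \<i>)) - cnj (?q (- 1)) + \<i> * cnj (?q \<i>)) / 4"
    unfolding sint_def sum_lessThan_4 p q by simp
  have "sint M (nkernel (complex_of_real x)) y w - cnj (sint M (nkernel (complex_of_real x)) w y)
      = ((?q 1 - cnj (?q 1)) + \<i> * (?q \<i> - cnj (?q \<i>)) - (?q (- 1) - cnj (?q (- 1))) - \<i> * (?q (- \<i>) - cnj (?q (- \<i>)))) / 4"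
    unfolding s1 s2 by (simp add: algebra_simps add_divide_distrib diff_divide_distrib)
  also have "\<dots> = 2 * \<i> * polarize (\<lambda>u. \<integral>t. cpoisson x t \<partial>qmeas M u) y w"
    unfolding im polarize_def sum_lessThan_4 p by (simp add: algebra_simps)
  finally show ?thesis
    unfolding Imu_def Nmu_def by (simp add: field_simps)
qed

lemma stieltjes_sum_LIMSEQ:
  assumes M: "opmeasure M" and ab: "0 < a" "a < b"
  shows "(\<lambda>n. stieltjes_sum M (cpoisson x) a b n y w)
    \<longlonglongrightarrow> polarize (\<lambda>u. \<integral>t. indicator {a<..b} t * cpoisson x t \<partial>qmeas M u) y w"
  unfolding stieltjes_sum_polarize[OF assms]
  using riemann_stieltjes_qmeas[OF assms continuous_on_cpoisson[of x]]
  by (intro tendsto_polarize) simp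

lemma polarize_exhaustion_LIMSEQ:
  assumes M: "carleson M"
  shows "(\<lambda>k. polarize (\<lambda>u. \<integral>t. indicator {exh_lo k<..exh_hi k} t * cpoisson x t \<partial>qmeas M u) y w)
    \<longlonglongrightarrow> polarize (\<lambda>u. \<integral>t. cpoisson x t \<partial>qmeas M u) y w"
proof (rule tendsto_polarize)
  fix u
  note i = integrable_cpoisson[OF M, of u x]
  show "(\<lambda>k. \<integral>t. indicator {exh_lo k<..exh_hi k} t * cpoisson x t \<partial>qmeas M u) \<longlonglongrightarrow> (\<integral>t. cpoisson x t \<partial>qmeas M u)"
  proof (rule integral_dominated_convergence[where w = "\<lambda>t. \<bar>cpoisson x t\<bar>"])
    show "cpoisson x \<in> borel_measurable (qmeas M u)" using i by simp
    show "integrable (qmeas M u) (\<lambda>t. \<bar>cpoisson x t\<bar>)" using i by simp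
    show "(\<lambda>t. indicator {exh_lo k<..exh_hi k} t * cpoisson x t) \<in> borel_measurable (qmeas M u)" for k
      using i exh_bounds(1)[of k]
      by (intro borel_measurable_times borel_measurable_indicator) (auto simp: sets_qmeas_iff)
    show "AE t in qmeas M u. norm (indicator {exh_lo k<..exh_hi k} t * cpoisson x t) \<le> \<bar>cpoisson x t\<bar>" for k
      by (intro AE_I2) (auto simp: indicator_def)
    show "AE t in qmeas M u. (\<lambda>k. indicator {exh_lo k<..exh_hi k} t * cpoisson x t) \<longlonglongrightarrow> cpoisson x t"
    proof (rule AE_I2)
      fix t assume "t \<in> space (qmeas M u)"
      then have "(\<lambda>k. indicator {exh_lo k<..exh_hi k} t * cpoisson x t) \<longlonglongrightarrow> 1 * cpoisson x t"
        by (intro tendsto_intros exh_indicator_LIMSEQ) simp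
      then show "(\<lambda>k. indicator {exh_lo k<..exh_hi k} t * cpoisson x t) \<longlonglongrightarrow> cpoisson x t" by simp
    qed
  qed
qed

text \<open>The constant is independent of \<open>x\<close>, of the interval and of the partition.
  In absolute value the kernel decreases in \<open>t\<close>, so on quadratic forms the sums are
  dominated by lower sums of the integral in \<open>carleson_poisson_bound\<close>. Polarization and
  normalization cost the factor 4.\<close>

lemma stieltjes_sum_bound:
  assumes M: "carleson M"
  obtains C where "0 \<le> C" and "\<And>x a b n y w. 0 < a \<Longrightarrow> a < b \<Longrightarrow>
    cmod (stieltjes_sum M (cpoisson x) a b n y w) \<le> C * norm y * norm w"
proof -
  have M': "opmeasure M" using M by (simp add: carleson_def)
  obtain C where C: "0 \<le> C"
    "\<And>x v. integrable (qmeas M v) (\<lambda>t. \<bar>x\<bar> / (t\<^sup>2 + x\<^sup>2))"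
    "\<And>x v. (\<integral>t. \<bar>x\<bar> / (t\<^sup>2 + x\<^sup>2) \<partial>qmeas M v) \<le> C * (norm v)\<^sup>2"
    using carleson_poisson_bound[OF M] by blast
  have "cmod (stieltjes_sum M (cpoisson x) a b n y w) \<le> 4 * C * norm y * norm w"
    if ab: "0 < a" "a < b" for x a b n y w
  proof (rule bilinear_form_bound[of "stieltjes_sum M (cpoisson x) a b n"])
    show "stieltjes_sum M (cpoisson x) a b n (r *\<^sub>R y) (s *\<^sub>R w)
        = complex_of_real (r * s) * stieltjes_sum M (cpoisson x) a b n y w" for r s y w
      by (rule stieltjes_sum_scaleR[OF M' ab])
    have "\<bar>\<Sum>j\<in>{1..n}. qform M u (cell a b n j) * cpoisson x (grid a b n j)\<bar> \<le> C * (norm u)\<^sup>2" for u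
    proof -
      have "\<bar>\<Sum>j\<in>{1..n}. qform M u (cell a b n j) * cpoisson x (grid a b n j)\<bar>
          \<le> (\<Sum>j\<in>{1..n}. \<bar>qform M u (cell a b n j) * cpoisson x (grid a b n j)\<bar>)"
        by (rule sum_abs)
      also have "\<dots> = (\<Sum>j\<in>{1..n}. qform M u (cell a b n j) * (\<bar>x\<bar> / ((grid a b n j)\<^sup>2 + x\<^sup>2)))"
        using pos_op_nonneg[OF pos_op_cell[OF M' ab]]
        by (intro sum.cong refl) (simp add: abs_mult abs_cpoisson qform_def)
      also have "\<dots> \<le> (\<integral>t. \<bar>x\<bar> / (t\<^sup>2 + x\<^sup>2) \<partial>qmeas M u)"
      proof (rule riemann_stieltjes_le_integral[OF M' ab _ _ C(2)])
        show "\<bar>x\<bar> / (t\<^sup>2 + x\<^sup>2) \<le> \<bar>x\<bar> / (s\<^sup>2 + x\<^sup>2)" if "0 < s" "s \<le> t" for s t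
          using that by (intro divide_left_mono add_right_mono power_mono mult_pos_pos add_pos_nonneg) auto
      qed simp
      also have "\<dots> \<le> C * (norm u)\<^sup>2" by (rule C(3))
      finally show ?thesis .
    qed
    then show "cmod (stieltjes_sum M (cpoisson x) a b n y w) \<le> C * (norm w + norm y)\<^sup>2" for y w
      unfolding stieltjes_sum_polarize[OF M' ab] by (rule norm_polarize_le)
  qed
  then show ?thesis using C(1) by (intro that[of "4 * C"]) auto
qed

lemma measurable_cpoisson: "(\<lambda>x. complex_of_real (cpoisson x t)) \<in> borel_measurable lebesgue"
proof (rule measurable_completion)
  show "(\<lambda>x. complex_of_real (cpoisson x t)) \<in> borel_measurable lborel"
    unfolding cpoisson_def by measurable
qed

text \<open>At this stage the exchange with the integral over the real line is that of a finite sum: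
  each cell acts as a point mass placed at its right endpoint.\<close>

lemma integral_stieltjes_sum:
  assumes M: "opmeasure M" and F: "hardy2 F f" and G: "hardy2 G g" and ab: "0 < a" "a < b"
  shows "integrable lebesgue (\<lambda>x. stieltjes_sum M (cpoisson x) a b n (f x) (g (- x)))"
    and "(\<integral>x. stieltjes_sum M (cpoisson x) a b n (f x) (g (- x)) \<partial>lebesgue)
      = - (\<i> * complex_of_real pi) *
        rs_sum M (\<lambda>t. F (\<i> * complex_of_real t)) (\<lambda>t. G (\<i> * complex_of_real t)) a b n"
proof -
  have pos: "0 < grid a b n j" if "j \<in> {1..n}" for j
    using grid_bounds(1)[of a b j n] ab that by simp
  note point = integrable_point_mass_symbol[OF F G pos_op_cell[OF M ab] pos]
    integral_point_mass_symbol[OF F G pos_op_cell[OF M ab] pos]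
  show "integrable lebesgue (\<lambda>x. stieltjes_sum M (cpoisson x) a b n (f x) (g (- x)))"
    unfolding stieltjes_sum_def cpoisson_def
    by (intro Bochner_Integration.integrable_sum point)
  show "(\<integral>x. stieltjes_sum M (cpoisson x) a b n (f x) (g (- x)) \<partial>lebesgue)
      = - (\<i> * complex_of_real pi) *
        rs_sum M (\<lambda>t. F (\<i> * complex_of_real t)) (\<lambda>t. G (\<i> * complex_of_real t)) a b n"
    unfolding stieltjes_sum_def cpoisson_def rs_sum_cells sum_distrib_left
  proof (subst Bochner_Integration.integral_sum)
    fix j assume j: "j \<in> {1..n}"
    show "integrable lebesgue (\<lambda>x. complex_of_real (x / (x\<^sup>2 + (grid a b n j)\<^sup>2)) * cinner (f x) (M (cell a b n j) (g (- x))))"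
      by (rule point(1)[OF j j])
  qed (intro sum.cong refl point(2))
qed

text \<open>The limits in the Stieltjes sums and in the exhaustion of the half-line pass through the
  integral over the real line because the sums are bounded uniformly in \<^term>\<open>x\<close>.\<close>

theorem theorem2p15:
  fixes M :: "real set \<Rightarrow> 'k::chilbert \<Rightarrow> 'k"
  assumes "carleson M"
  shows "(\<forall>x v. x \<noteq> 0 \<longrightarrow> integrable (qmeas M v) (nkernel (complex_of_real x)))
       \<and> symbol_of_Hmu (\<lambda>x y w. \<i> * Imu M x y w) M"
proof -
  have M: "opmeasure M" using assms by (simp add: carleson_def)
  \<comment> \<open>Combines the factor \<open>\<i>\<close> of the symbol with the
    \<open>1 / pi\<close> of \<open>Nmu\<close>. Its product with \<open>- (\<i> * pi)\<close> is 1,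
    which cancels the constant of the point masses.\<close>
  define c where "c = \<i> / complex_of_real pi"
  define s where "s k n x y w = c * stieltjes_sum M (cpoisson x) (exh_lo k) (exh_hi k) n y w" for k n x y w
  define S where "S k x y w = c * polarize (\<lambda>u. \<integral>t. indicator {exh_lo k<..exh_hi k} t * cpoisson x t \<partial>qmeas M u) y w" for k x y w
  let ?h = "\<lambda>x y w. \<i> * Imu M x y w"
  obtain C0 where C0: "0 \<le> C0" "\<And>x a b n y w. 0 < a \<Longrightarrow> a < b \<Longrightarrow>
      cmod (stieltjes_sum M (cpoisson x) a b n y w) \<le> C0 * norm y * norm w"
    using stieltjes_sum_bound[OF assms] by blast
  define C where "C = cmod c * C0"
  have C: "0 \<le> C" using C0(1) by (simp add: C_def)
  have s_le: "cmod (s k n x y w) \<le> C * norm y * norm w" for k n x y w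
    using mult_left_mono[OF C0(2)[OF exh_bounds], of "cmod c" x k n y w]
    by (simp add: s_def C_def norm_mult mult.assoc)
  have s_lim: "(\<lambda>n. s k n x y w) \<longlonglongrightarrow> S k x y w" for k x y w
    unfolding s_def S_def by (intro tendsto_intros stieltjes_sum_LIMSEQ M exh_bounds)
  have S_lim: "(\<lambda>k. S k x y w) \<longlonglongrightarrow> ?h x y w" if "x \<noteq> 0" for x y w
  proof -
    have "?h x y w = c * polarize (\<lambda>u. \<integral>t. cpoisson x t \<partial>qmeas M u) y w"
      by (simp add: Imu_eq_polarize[OF assms that] c_def)
    then show ?thesis
      unfolding S_def by (simp only:) (intro tendsto_intros polarize_exhaustion_LIMSEQ[OF assms])
  qed
  have S_le: "cmod (S k x y w) \<le> C * norm y * norm w" for k x y w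
    by (rule LIMSEQ_le_const2[OF tendsto_norm[OF s_lim]]) (use s_le in blast)
  have h_le: "cmod (?h x y w) \<le> C * norm y * norm w" if "x \<noteq> 0" for x y w
    by (rule LIMSEQ_le_const2[OF tendsto_norm[OF S_lim[OF that]]]) (use S_le in blast)
  \<comment> \<open>The formula for \<open>Imu\<close> was derived for nonzero \<open>x\<close>; the
    excluded point is a null set.\<close>
  have AE0: "AE x in lebesgue. x \<noteq> (0::real)"
    using AE_not_in[of "{0::real}" lebesgue] by simp
  have "Linf_op ?h"
    unfolding Linf_op_def
  proof (intro conjI allI exI)
    fix y w
    have "(\<lambda>x. s k n x y w) \<in> borel_measurable lebesgue" for k n
      unfolding s_def stieltjes_sum_def by (intro borel_measurable_times borel_measurable_sum measurable_cpoisson) simp_all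
    then have "(\<lambda>x. S k x y w) \<in> borel_measurable lebesgue" for k
      by (rule borel_measurable_lebesgue_LIMSEQ_AE[where u = "\<lambda>n x. s k n x y w"]) (intro AE_I2 s_lim)
    then show "(\<lambda>x. ?h x y w) \<in> borel_measurable lebesgue"
      by (rule borel_measurable_lebesgue_LIMSEQ_AE[where u = "\<lambda>k x. S k x y w"])
        (rule eventually_mono[OF AE0], rule S_lim)
  next
    show "AE x in lebesgue. \<forall>y w. cmod (?h x y w) \<le> C * norm y * norm w"
      using AE0 by eventually_elim (use h_le in blast)
  qed
  moreover have "integrable lebesgue (\<lambda>x. ?h x (f x) (g (- x))) \<and> L = (\<integral>x. ?h x (f x) (g (- x)) \<partial>lebesgue)"
    if F: "hardy2 F f" and G: "hardy2 G g" and L: "carleson_form M F G L" for F f G g L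
  proof -
    let ?\<phi> = "\<lambda>t. F (\<i> * complex_of_real t)" and ?\<psi> = "\<lambda>t. G (\<i> * complex_of_real t)"
    \<comment> \<open>An integrable majorant common to all \<open>n\<close> and \<open>k\<close>:
      the uniform bound is a multiple of a product of two square integrable functions.\<close>
    let ?W = "\<lambda>x. C * ((norm (f x))\<^sup>2 + (norm (g (- x)))\<^sup>2)"
    have "L2fun f" "L2fun (\<lambda>x. g (- x))"
      using F G by (auto simp: hardy2_def intro: L2fun_reflect)
    then have W: "integrable lebesgue ?W"
      by (intro integrable_mult_right Bochner_Integration.integrable_add L2fun_square_integrable)
    have le_W: "C * norm (f x) * norm (g (- x)) \<le> ?W x" for x
    proof -
      have "norm (f x) * norm (g (- x)) \<le> (norm (f x))\<^sup>2 + (norm (g (- x)))\<^sup>2"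
        using weighted_am_gm[of 1 "norm (f x)" "norm (g (- x))"]
          mult_nonneg_nonneg[OF norm_ge_zero[of "f x"] norm_ge_zero[of "g (- x)"]] by linarith
      then show ?thesis using mult_left_mono[OF _ C] by (simp add: mult.assoc)
    qed
    have si: "integrable lebesgue (\<lambda>x. s k n x (f x) (g (- x)))" for k n
      unfolding s_def by (intro integrable_mult_right integral_stieltjes_sum(1)[OF M F G exh_bounds])
    have sint: "(\<integral>x. s k n x (f x) (g (- x)) \<partial>lebesgue) = rs_sum M ?\<phi> ?\<psi> (exh_lo k) (exh_hi k) n" for k n
      unfolding s_def integral_mult_right_zero integral_stieltjes_sum(2)[OF M F G exh_bounds]
      by (simp add: c_def)
    \<comment> \<open>The vectors vary with \<open>x\<close>, so measurability of the coefficients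
      for fixed vectors does not suffice. It is inherited from the finite sums, where it holds
      because the pairings of \<open>f\<close> and the reflected \<open>g\<close> are
      integrable.\<close>
    have Sm: "(\<lambda>x. S k x (f x) (g (- x))) \<in> borel_measurable lebesgue" for k
      by (rule borel_measurable_lebesgue_LIMSEQ_AE[where u = "\<lambda>n x. s k n x (f x) (g (- x))"])
        (intro borel_measurable_integrable si AE_I2 s_lim)+
    have hm: "(\<lambda>x. ?h x (f x) (g (- x))) \<in> borel_measurable lebesgue"
      by (rule borel_measurable_lebesgue_LIMSEQ_AE[where u = "\<lambda>k x. S k x (f x) (g (- x))"])
        (rule Sm, rule eventually_mono[OF AE0], rule S_lim)
    have "rs_sum M ?\<phi> ?\<psi> (exh_lo k) (exh_hi k) \<longlonglongrightarrow> (\<integral>x. S k x (f x) (g (- x)) \<partial>lebesgue)" for k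
      unfolding sint[symmetric]
      by (rule integral_dominated_convergence[OF Sm borel_measurable_integrable[OF si] W])
        (intro AE_I2 s_lim order_trans[OF s_le le_W])+
    then have "lim (rs_sum M ?\<phi> ?\<psi> (exh_lo k) (exh_hi k)) = (\<integral>x. S k x (f x) (g (- x)) \<partial>lebesgue)" for k
      by (rule limI)
    \<comment> \<open>Along the exhaustion these integrals are exactly the truncated Carleson
      integrals, so their limit is \<open>L\<close> by the definition of the form. The remaining
      limit, taken inside the integral, identifies \<open>L\<close> with the pairing of the
      symbol.\<close>
    then have L1: "(\<lambda>k. \<integral>x. S k x (f x) (g (- x)) \<partial>lebesgue) \<longlonglongrightarrow> L"
      using opint_exh[OF L[unfolded carleson_form_def]] by simp
    have lim: "AE x in lebesgue. (\<lambda>k. S k x (f x) (g (- x))) \<longlonglongrightarrow> ?h x (f x) (g (- x))"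
      using AE0 by eventually_elim (rule S_lim)
    have le: "AE x in lebesgue. norm (S k x (f x) (g (- x))) \<le> ?W x" for k
      by (intro AE_I2 order_trans[OF S_le le_W])
    have L2: "(\<lambda>k. \<integral>x. S k x (f x) (g (- x)) \<partial>lebesgue) \<longlonglongrightarrow> (\<integral>x. ?h x (f x) (g (- x)) \<partial>lebesgue)"
      by (rule integral_dominated_convergence[OF hm Sm W lim le])
    show ?thesis
      using integrable_dominated_convergence[OF hm Sm W lim le] LIMSEQ_unique[OF L1 L2] by simp
  qed
  ultimately show ?thesis
    unfolding symbol_of_Hmu_def using integrable_nkernel[OF assms] by blast
qed

end
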